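(* Let $(G_N)_{N\ge1}$ be a sequence of configuration models $\mathrm{CM}_N(\mathbf 1,\mathbf 2)$ for a given $p\in(0,1)$. Then, for all $\beta>0$ and $B\in\mathbb R$, the following hold. (i) The annealed pressure exists in the thermodynamic limit $N\to\infty$ and is given by $$\widetilde\psi(\beta,B):=\lim_{N\to\infty}\widetilde\psi_N(\beta,B)=\log\lambda_+(\beta,B)+\frac{1-p}{2}\log A_+(\beta,B)+H(s^*,t^* ),$$ where $H:[0,\frac{1-p}2]\times[0,p]\to\mathbb R$ is the function defined in the context and $(s^*,t^* )=(s^*(\beta,B),t^*(\beta,B))$ is the unique maximum point of $(s,t)\mapsto H(s,t)$ on $[0,\frac{1-p}2]\times[0,p]$. (ii) The magnetization per vertex exists in the limit $N\to\infty$, i.e. $\widetilde M(\beta,B):=\lim_{N\to\infty}\widetilde M_N(\beta,B)=\frac{\partial}{\partial B}\widetilde\psi(\beta,B)$, and is given by $$\widetilde M(\beta,B)=\frac{\partial}{\partial B}\log\lambda_+(\beta,B)+\frac{1-p}2\frac{\partial}{\partial B}\log A_+(\beta,B)+s^*(\beta,B)\frac{\partial}{\partial B}\log\big[a(\beta,B)r^2(\beta,B)\big]+t^*(\beta,B)\frac{\partial}{\partial B}\log r(\beta,B).$$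
   Context: Configuration model: given degrees $(d_i)_{i\in[N]}$ with even sum, attach $d_i$ half-edges to vertex $i\in[N]=\{1,\dots,N\}$ and pair all half-edges uniformly at random; each pair forms an edge, giving a random multigraph (self-loops and multiple edges allowed). $\mathrm{CM}_N(\mathbf 1,\mathbf 2)$ has $n_2=\lfloor pN\rfloor$ vertices of degree 2 and $n_1=N-\lfloor pN\rfloor$ vertices of degree 1; the total degree $N+\lfloor pN\rfloor$ is assumed even. Annealed Ising model: let $Q_N$ denote the law of the random multigraph $G_N=([N],E_N)$ and also the corresponding expectation; $E_N$ is counted with multiplicity, and a self-loop at $i$ contributes a term $\sigma_i\sigma_i=1$ once. For $\beta\ge0$, $B\in\mathbb R$ the annealed measure on $\sigma\in\{-1,1\}^N$ is $$\widetilde P_N(\sigma)=\frac{Q_N\big(\exp[\beta\sum_{(i,j)\in E_N}\sigma_i\sigma_j+B\sum_{i\in[N]}\sigma_i]\big)}{Q_N(Z_N(\beta,B))},\qquad Z_N(\beta,B)=\sum_{\sigma\in\{-1,1\}^N}\exp\Big[\beta\sum_{(i,j)\in E_N}\sigma_i\sigma_j+B\sum_{i\in[N]}\sigma_i\Big].$$ $\widetilde P_N(\cdot)$ also denotes expectation. $S_N=\sum_{i\in[N]}\sigma_i$; $\widetilde\psi_N(\beta,B)=\frac1N\log Q_N(Z_N(\beta,B))$; $\widetilde M_N(\beta,B)=\widetilde P_N(S_N/N)$. Functions: $\lambda_\pm=\lambda_\pm(\beta,B)=e^{\beta}\big[\cosh(B)\pm\sqrt{\sinh^2(B)+e^{-4\beta}}\big]$,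 $r=r(\beta,B)=\lambda_-/\lambda_+$, $$A_\pm=A_\pm(\beta,B)=\frac{e^{-2\beta}e^{\pm B}+(\lambda_+-e^{\beta+B})^2e^{\mp B}\pm2e^{-\beta}(\lambda_+-e^{\beta+B})}{[e^{-2\beta}+(\lambda_+-e^{\beta+B})^2]\lambda_\pm},\qquad a=a(\beta,B)=\frac{A_-}{A_+}.$$ The function $H$ on $[0,\frac{1-p}2]\times[0,p]$ (which depends on $(\beta,B)$ through $a$ and $r$) is given in the interior by $$\begin{aligned}H(s,t)=\;&(1-p)\log\tfrac{1-p}2-2s\log s-2\big(\tfrac{1-p}2-s\big)\log\big(\tfrac{1-p}2-s\big)+s\log(ar^2)+t\log r\\&+(s+t)\log(s+t)-t\log t+\big(\tfrac{1+p}2-s-t\big)\log\big(\tfrac{1+p}2-s-t\big)\\&-(p-t)\log(p-t)-\tfrac{1+p}2\log\tfrac{1+p}2+p\log p,\end{aligned}$$ and is extended by continuity to the boundary.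
   Formalization: Limits run along the N with N+⌊pN⌋ even, as it cannot be even for all N. At B=0, where a=0 and log(ar²) is undefined, H is taken extended-real (s·log 0 is −∞ for s>0 and 0 for s=0), and the term s*·∂_B log(ar²) is read as 0 since s*=0. *)

theory Defs
  imports "HOL-Probability.Probability" "HOL-Real_Asymp.Real_Asymp"
begin

section \<open>The configuration model\<close>

text \<open>
  The half-edges of vertex \<open>i\<close> are the pairs \<open>(i, k)\<close> with \<open>k < d i\<close>.
\<close>

definition half_edges :: "nat \<Rightarrow> (nat \<Rightarrow> nat) \<Rightarrow> (nat \<times> nat) set" where
  "half_edges N d = (SIGMA i:{1..N}. {..<d i})"

definition pairings :: "'a set \<Rightarrow> 'a set set set" where
  "pairings A = {P. partition_on A P \<and> (\<forall>e\<in>P. card e = 2)}"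

text \<open>
  An edge is represented by the two-element multiset of its endpoints, so that a self-loop at \<open>i\<close>
  is \<open>{#i, i#}\<close>, and a multigraph on \<open>{1..N}\<close> by the multiset of its edges.
\<close>

definition pairing_edges :: "(nat \<times> nat) set set \<Rightarrow> nat multiset multiset" where
  "pairing_edges P = image_mset (\<lambda>e. image_mset fst (mset_set e)) (mset_set P)"

text \<open>
  The law of the configuration model is only meaningful if the total degree is even, since
  otherwise there are no pairings.
\<close>

definition configuration_model :: "nat \<Rightarrow> (nat \<Rightarrow> nat) \<Rightarrow> nat multiset multiset pmf" where
  "configuration_model N d = map_pmf pairing_edges (pmf_of_set (pairings (half_edges N d)))"

definition CM12_degrees :: "real \<Rightarrow> nat \<Rightarrow> (nat \<Rightarrow> nat) \<Rightarrow> bool" where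
  "CM12_degrees p N d \<longleftrightarrow>
     (\<forall>i\<in>{1..N}. d i = 1 \<or> d i = 2) \<and> card {i\<in>{1..N}. d i = 2} = nat \<lfloor>p * real N\<rfloor>"

text \<open>
  The filter \<open>N \<rightarrow> \<infinity>\<close> along those \<open>N\<close> for which the total degree is even. For \<open>p < 1\<close> the total degree
  is even for infinitely many \<open>N\<close> and odd for infinitely many \<open>N\<close>.
\<close>

definition even_degree_sizes :: "real \<Rightarrow> nat filter" where
  "even_degree_sizes p = inf sequentially (principal {N. even (N + nat \<lfloor>p * real N\<rfloor>)})"


section \<open>The annealed Ising model\<close>

definition spin_configs :: "nat \<Rightarrow> (nat \<Rightarrow> real) set" where
  "spin_configs N = {1..N} \<rightarrow>\<^sub>E {-1, 1}"

definition total_spin :: "nat \<Rightarrow> (nat \<Rightarrow> real) \<Rightarrow> real" where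
  "total_spin N \<sigma> = (\<Sum>i\<in>{1..N}. \<sigma> i)"

definition boltzmann_weight ::
  "nat \<Rightarrow> real \<Rightarrow> real \<Rightarrow> nat multiset multiset \<Rightarrow> (nat \<Rightarrow> real) \<Rightarrow> real" where
  "boltzmann_weight N \<beta> B E \<sigma> = exp (\<beta> * (\<Sum>e\<in>#E. \<Prod>i\<in>#e. \<sigma> i) + B * total_spin N \<sigma>)"

definition partition_function :: "nat \<Rightarrow> real \<Rightarrow> real \<Rightarrow> nat multiset multiset \<Rightarrow> real" where
  "partition_function N \<beta> B E = (\<Sum>\<sigma>\<in>spin_configs N. boltzmann_weight N \<beta> B E \<sigma>)"

definition annealed_partition_function :: "nat \<Rightarrow> (nat \<Rightarrow> nat) \<Rightarrow> real \<Rightarrow> real \<Rightarrow> real" where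
  "annealed_partition_function N d \<beta> B =
     measure_pmf.expectation (configuration_model N d) (partition_function N \<beta> B)"

definition annealed_prob ::
  "nat \<Rightarrow> (nat \<Rightarrow> nat) \<Rightarrow> real \<Rightarrow> real \<Rightarrow> (nat \<Rightarrow> real) \<Rightarrow> real" where
  "annealed_prob N d \<beta> B \<sigma> =
     measure_pmf.expectation (configuration_model N d) (\<lambda>E. boltzmann_weight N \<beta> B E \<sigma>)
       / annealed_partition_function N d \<beta> B"

definition annealed_expectation ::
  "nat \<Rightarrow> (nat \<Rightarrow> nat) \<Rightarrow> real \<Rightarrow> real \<Rightarrow> ((nat \<Rightarrow> real) \<Rightarrow> real) \<Rightarrow> real" where
  "annealed_expectation N d \<beta> B f = (\<Sum>\<sigma>\<in>spin_configs N. f \<sigma> * annealed_prob N d \<beta> B \<sigma>)"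

definition annealed_pressure :: "nat \<Rightarrow> (nat \<Rightarrow> nat) \<Rightarrow> real \<Rightarrow> real \<Rightarrow> real" where
  "annealed_pressure N d \<beta> B = 1 / real N * ln (annealed_partition_function N d \<beta> B)"

definition annealed_magnetization :: "nat \<Rightarrow> (nat \<Rightarrow> nat) \<Rightarrow> real \<Rightarrow> real \<Rightarrow> real" where
  "annealed_magnetization N d \<beta> B = annealed_expectation N d \<beta> B (\<lambda>\<sigma>. total_spin N \<sigma> / real N)"

text \<open>In the thermodynamic limit, \<open>d N\<close> is the degree sequence of the graph of size \<open>N\<close>.\<close>

definition limit_pressure :: "real \<Rightarrow> (nat \<Rightarrow> nat \<Rightarrow> nat) \<Rightarrow> real \<Rightarrow> real \<Rightarrow> real" where
  "limit_pressure p d \<beta> B = Lim (even_degree_sizes p) (\<lambda>N. annealed_pressure N (d N) \<beta> B)"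

definition limit_magnetization :: "real \<Rightarrow> (nat \<Rightarrow> nat \<Rightarrow> nat) \<Rightarrow> real \<Rightarrow> real \<Rightarrow> real" where
  "limit_magnetization p d \<beta> B =
     Lim (even_degree_sizes p) (\<lambda>N. annealed_magnetization N (d N) \<beta> B)"


section \<open>The functions in the variational formula\<close>

definition lam_plus :: "real \<Rightarrow> real \<Rightarrow> real" where
  "lam_plus \<beta> B = exp \<beta> * (cosh B + sqrt ((sinh B)\<^sup>2 + exp (- 4 * \<beta>)))"

definition lam_minus :: "real \<Rightarrow> real \<Rightarrow> real" where
  "lam_minus \<beta> B = exp \<beta> * (cosh B - sqrt ((sinh B)\<^sup>2 + exp (- 4 * \<beta>)))"

definition r_ratio :: "real \<Rightarrow> real \<Rightarrow> real" where
  "r_ratio \<beta> B = lam_minus \<beta> B / lam_plus \<beta> B"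

definition A_plus :: "real \<Rightarrow> real \<Rightarrow> real" where
  "A_plus \<beta> B =
     (exp (- 2 * \<beta>) * exp B + (lam_plus \<beta> B - exp (\<beta> + B))\<^sup>2 * exp (- B)
        + 2 * exp (- \<beta>) * (lam_plus \<beta> B - exp (\<beta> + B)))
     / ((exp (- 2 * \<beta>) + (lam_plus \<beta> B - exp (\<beta> + B))\<^sup>2) * lam_plus \<beta> B)"

definition A_minus :: "real \<Rightarrow> real \<Rightarrow> real" where
  "A_minus \<beta> B =
     (exp (- 2 * \<beta>) * exp (- B) + (lam_plus \<beta> B - exp (\<beta> + B))\<^sup>2 * exp B
        - 2 * exp (- \<beta>) * (lam_plus \<beta> B - exp (\<beta> + B)))
     / ((exp (- 2 * \<beta>) + (lam_plus \<beta> B - exp (\<beta> + B))\<^sup>2) * lam_minus \<beta> B)"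

definition a_ratio :: "real \<Rightarrow> real \<Rightarrow> real" where
  "a_ratio \<beta> B = A_minus \<beta> B / A_plus \<beta> B"

definition ext_ln :: "real \<Rightarrow> ereal" where
  "ext_ln x = (if x = 0 then - \<infinity> else ereal (ln x))"

definition H_domain :: "real \<Rightarrow> (real \<times> real) set" where
  "H_domain p = {0..(1 - p) / 2} \<times> {0..p}"

definition H_finite_part :: "real \<Rightarrow> real \<Rightarrow> real \<Rightarrow> real \<times> real \<Rightarrow> real" where
  "H_finite_part p \<beta> B = (\<lambda>(s, t).
     (1 - p) * ln ((1 - p) / 2) - 2 * s * ln s - 2 * ((1 - p) / 2 - s) * ln ((1 - p) / 2 - s)
     + t * ln (r_ratio \<beta> B)
     + (s + t) * ln (s + t) - t * ln t + ((1 + p) / 2 - s - t) * ln ((1 + p) / 2 - s - t)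
     - (p - t) * ln (p - t) - (1 + p) / 2 * ln ((1 + p) / 2) + p * ln p)"

text \<open>
  The extension by continuity to the boundary amounts to \<open>0 * ln 0 = 0\<close>, which holds since
  \<open>ln 0 = 0\<close> in the library.

  For \<open>\<beta> > 0\<close> the factor \<open>a r\<^sup>2\<close> is positive if \<open>B \<noteq> 0\<close> but vanishes if \<open>B = 0\<close>. In the latter case
  \<open>s log (a r\<^sup>2)\<close> has to be read as \<open>- \<infinity>\<close> for \<open>s > 0\<close> and as \<open>0\<close> for \<open>s = 0\<close>, which is
  its limit as \<open>B \<rightarrow> 0\<close> with \<open>s\<close> fixed. Hence \<open>H\<close> takes extended real values (where
  \<open>0 * (- \<infinity>) = 0\<close>); it is finite and continuous if \<open>B \<noteq> 0\<close>.
\<close>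

definition H_fun :: "real \<Rightarrow> real \<Rightarrow> real \<Rightarrow> real \<times> real \<Rightarrow> ereal" where
  "H_fun p \<beta> B = (\<lambda>(s, t).
     ereal (H_finite_part p \<beta> B (s, t)) + ereal s * ext_ln (a_ratio \<beta> B * (r_ratio \<beta> B)\<^sup>2))"

definition s_star :: "real \<Rightarrow> real \<Rightarrow> real \<Rightarrow> real" where
  "s_star p \<beta> B = fst (arg_max_on (H_fun p \<beta> B) (H_domain p))"

definition t_star :: "real \<Rightarrow> real \<Rightarrow> real \<Rightarrow> real" where
  "t_star p \<beta> B = snd (arg_max_on (H_fun p \<beta> B) (H_domain p))"

lemma lam_minus_pos: "lam_minus \<beta> B > 0" if "\<beta> > 0"
proof -
  have "(sinh B)\<^sup>2 + exp (- 4 * \<beta>) < (cosh B)\<^sup>2"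
    using that by (simp add: cosh_square_eq)
  hence "sqrt ((sinh B)\<^sup>2 + exp (- 4 * \<beta>)) < cosh B"
    by (metis cosh_real_pos less_eq_real_def real_sqrt_less_iff real_sqrt_unique)
  thus ?thesis by (simp add: lam_minus_def)
qed

lemma lam_plus_gt: "lam_plus \<beta> B > exp (\<beta> + B)"
proof -
  have "sinh B < sqrt ((sinh B)\<^sup>2 + exp (- 4 * \<beta>))"
    by (rule real_less_rsqrt) simp
  hence "cosh B + sinh B < cosh B + sqrt ((sinh B)\<^sup>2 + exp (- 4 * \<beta>))" by simp
  thus ?thesis by (simp add: lam_plus_def exp_add cosh_plus_sinh)
qed

lemma A_plus_pos: "A_plus \<beta> B > 0"
proof -
  have "lam_plus \<beta> B > 0" using lam_plus_gt[of \<beta> B] exp_gt_zero[of "\<beta> + B"] by linarith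
  thus ?thesis unfolding A_plus_def
    using lam_plus_gt[of \<beta> B]
    by (intro divide_pos_pos add_pos_pos mult_pos_pos add_pos_nonneg) auto
qed

lemma lam_plus_char:
  "(lam_plus \<beta> B - exp (\<beta> + B)) * (lam_plus \<beta> B - exp (\<beta> - B)) = exp (- 2 * \<beta>)"
proof -
  define q where "q = sqrt ((sinh B)\<^sup>2 + exp (- 4 * \<beta>))"
  have q: "q\<^sup>2 = (sinh B)\<^sup>2 + exp (- 4 * \<beta>)" unfolding q_def by simp
  have "exp (\<beta> + B) = exp \<beta> * (cosh B + sinh B)"
    by (simp only: exp_add cosh_plus_sinh)
  hence 1: "lam_plus \<beta> B - exp (\<beta> + B) = exp \<beta> * (q - sinh B)"
    unfolding lam_plus_def q_def[symmetric] by algebra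
  have "exp (\<beta> - B) = exp \<beta> * (cosh B - sinh B)"
    by (simp only: diff_conv_add_uminus[of \<beta> B] exp_add cosh_minus_sinh)
  hence 2: "lam_plus \<beta> B - exp (\<beta> - B) = exp \<beta> * (q + sinh B)"
    unfolding lam_plus_def q_def[symmetric] by algebra
  have "exp \<beta> * (q - sinh B) * (exp \<beta> * (q + sinh B)) = (exp \<beta>)\<^sup>2 * (q\<^sup>2 - (sinh B)\<^sup>2)"
    by (simp add: algebra_simps power2_eq_square)
  also have "\<dots> = exp (- 2 * \<beta>)"
    by (simp add: q flip: exp_double exp_add)
  finally show ?thesis by (simp add: 1 2)
qed

lemma A_minus_eq_0_iff: "A_minus \<beta> B = 0 \<longleftrightarrow> B = 0" and A_minus_nonneg: "A_minus \<beta> B \<ge> 0"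
  if "\<beta> > 0"
proof -
  define x where "x = lam_plus \<beta> B - exp (\<beta> + B)"
  have x: "x > 0" using lam_plus_gt[of \<beta> B] by (simp add: x_def)
  define y where "y = exp (- \<beta>) * exp (- B / 2) - x * exp (B / 2)"
  have num: "exp (- 2 * \<beta>) * exp (- B) + x\<^sup>2 * exp B - 2 * exp (- \<beta>) * x = y\<^sup>2"
  proof -
    have "exp (- 2 * \<beta>) = (exp (- \<beta>))\<^sup>2" "exp (- B) = (exp (- B / 2))\<^sup>2" "exp B = (exp (B / 2))\<^sup>2"
      by (simp_all flip: exp_double)
    moreover have "exp (- B / 2) * exp (B / 2) = 1"
      by (simp flip: exp_add)
    ultimately show ?thesis unfolding y_def by algebra
  qed
  have den: "(exp (- 2 * \<beta>) + x\<^sup>2) * lam_minus \<beta> B > 0"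
    using lam_minus_pos[OF that] by (intro mult_pos_pos add_pos_nonneg) auto
  have A: "A_minus \<beta> B = y\<^sup>2 / ((exp (- 2 * \<beta>) + x\<^sup>2) * lam_minus \<beta> B)"
    unfolding A_minus_def x_def[symmetric] num ..
  show "A_minus \<beta> B \<ge> 0" unfolding A using den by simp
  have y0: "y = 0 \<longleftrightarrow> x = exp (- \<beta> - B)"
  proof -
    have "y = (exp (- \<beta> - B) - x) * exp (B / 2)"
      by (simp add: y_def algebra_simps flip: exp_add)
    hence "y = 0 \<longleftrightarrow> exp (- \<beta> - B) - x = 0" by simp
    thus ?thesis by linarith
  qed
  have ch: "x * (x + (exp (\<beta> + B) - exp (\<beta> - B))) = exp (- 2 * \<beta>)"
    using lam_plus_char[of \<beta> B] by (simp add: x_def algebra_simps)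
  have ne: "exp \<beta> \<noteq> exp (- \<beta>)" using that by simp
  have "x = exp (- \<beta> - B) \<longleftrightarrow> B = 0"
  proof
    assume eq: "x = exp (- \<beta> - B)"
    have "exp (- \<beta> - B) * (exp (- \<beta> - B) + (exp (\<beta> + B) - exp (\<beta> - B))) = exp (- \<beta> - B) * exp (- \<beta> + B)"
      using ch unfolding eq by (simp flip: exp_add)
    hence "exp (- \<beta> - B) + (exp (\<beta> + B) - exp (\<beta> - B)) = exp (- \<beta> + B)" by simp
    hence "(exp \<beta> - exp (- \<beta>)) * (exp B - exp (- B)) = 0"
      by (simp only: diff_conv_add_uminus[of _ B] exp_add) algebra
    hence "exp B = exp (- B)" using ne by simp
    thus "B = 0" by simp
  next
    assume "B = 0"
    hence "x\<^sup>2 = (exp (- \<beta>))\<^sup>2" using ch by (simp add: power2_eq_square flip: exp_add)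
    thus "x = exp (- \<beta> - B)" using x \<open>B = 0\<close> by (simp add: power2_eq_iff_nonneg)
  qed
  thus "A_minus \<beta> B = 0 \<longleftrightarrow> B = 0" unfolding A using den y0 by auto
qed

lemma continuous_on_x_ln_x: "continuous_on {0..} (\<lambda>x::real. x * ln x)"
proof (rule continuous_on_eq_continuous_within[THEN iffD2], rule ballI)
  fix x :: real assume "x \<in> {0..}"
  show "continuous (at x within {0..}) (\<lambda>x. x * ln x)"
  proof (cases "x = 0")
    case True
    have "((\<lambda>x::real. x * ln x) \<longlongrightarrow> 0) (at_right 0)" by real_asymp
    thus ?thesis
      by (simp add: True continuous_within at_within_Ici_at_right)
  next
    case False
    thus ?thesis by (auto intro!: continuous_intros)
  qed
qed

lemma continuous_on_mult_ln_self:
  fixes f :: "'a::topological_space \<Rightarrow> real"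
  assumes "continuous_on S f" "\<And>x. x \<in> S \<Longrightarrow> f x \<ge> 0"
  shows "continuous_on S (\<lambda>x. f x * ln (f x))"
  using continuous_on_compose2[OF continuous_on_x_ln_x assms(1)] assms(2) by auto

lemma continuous_on_H_finite_part: "continuous_on (H_domain p) (H_finite_part p \<beta> B)"
proof -
  have cont: "continuous_on (H_domain p) (\<lambda>z. f z * ln (f z))"
    if "continuous_on (H_domain p) f" "\<And>z. z \<in> H_domain p \<Longrightarrow> f z \<ge> 0"
    for f :: "real \<times> real \<Rightarrow> real"
    by (rule continuous_on_mult_ln_self[OF that])
  have 1: "continuous_on (H_domain p) (\<lambda>z. fst z * ln (fst z))"
    and 2: "continuous_on (H_domain p)
              (\<lambda>z. ((1 - p) / 2 - fst z) * ln ((1 - p) / 2 - fst z))"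
    and 3: "continuous_on (H_domain p) (\<lambda>z. (fst z + snd z) * ln (fst z + snd z))"
    and 4: "continuous_on (H_domain p) (\<lambda>z. snd z * ln (snd z))"
    and 5: "continuous_on (H_domain p)
              (\<lambda>z. ((1 + p) / 2 - fst z - snd z) * ln ((1 + p) / 2 - fst z - snd z))"
    and 6: "continuous_on (H_domain p) (\<lambda>z. (p - snd z) * ln (p - snd z))"
    by (rule cont; force intro!: continuous_intros simp: H_domain_def field_simps)+
  show ?thesis
    unfolding H_finite_part_def case_prod_unfold mult.assoc
    by (rule 1 2 3 4 5 6 continuous_on_add continuous_on_diff continuous_on_const
          continuous_on_mult_left continuous_on_mult_right continuous_on_snd continuous_on_id)+
qed

lemma continuous_on_H_fun:
  assumes "\<beta> > 0" "B \<noteq> 0"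
  shows "continuous_on (H_domain p) (H_fun p \<beta> B)"
proof -
  define c where "c = a_ratio \<beta> B * (r_ratio \<beta> B)\<^sup>2"
  have "lam_plus \<beta> B > 0" using lam_plus_gt[of \<beta> B] exp_gt_zero[of "\<beta> + B"] by linarith
  hence "c \<noteq> 0"
    using A_minus_eq_0_iff[OF assms(1), of B] A_plus_pos[of \<beta> B] lam_minus_pos[OF assms(1), of B] assms(2)
    by (simp add: c_def a_ratio_def r_ratio_def)
  hence eq: "H_fun p \<beta> B = (\<lambda>z. ereal (H_finite_part p \<beta> B z + fst z * ln c))"
    by (auto simp: H_fun_def ext_ln_def c_def fun_eq_iff)
  show ?thesis unfolding eq
    by (intro continuous_intros continuous_on_H_finite_part)
qed

end

theory Submission
  imports Defs
begin

text \<open>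
  The sum over all pairings of a product of covariances is a Gaussian moment (Wick's formula), and
  this turns the annealed partition function into an explicit finite sum. The edge weight
  \<open>exp (\<beta> \<sigma> \<tau>)\<close> is a positive semidefinite kernel on \<open>{-1, 1}\<close>, hence of the form
  \<open>u \<sigma> * u \<tau> + v \<sigma> * v \<tau>\<close>. With independent standard Gaussian variables \<open>X\<close> and \<open>Y\<close>, the sum over
  the pairings of the half-edges is therefore the expectation of the product of the linear forms
  \<open>u \<sigma> * X + v \<sigma> * Y\<close>, one for each half-edge (\<open>sum_pairings_eq_wick\<close>). The sum over the spins now
  factorizes over the vertices. If \<open>u\<close> and \<open>v\<close> are taken from the two eigenvectors of the transfer
  matrix, a vertex of degree 2 contributes \<open>\<lambda>\<^sub>+ X\<^sup>2 + \<lambda>\<^sub>- Y\<^sup>2\<close>, without a mixed term, and a vertex of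
  degree 1 contributes a linear form in which the squares of the two coefficients are
  \<open>A\<^sub>+ \<lambda>\<^sub>+\<^sup>2\<close> and \<open>A\<^sub>- \<lambda>\<^sub>-\<^sup>2\<close>. Expanding the product gives \<open>annealed_partition_function_eq\<close>:
  \<open>\<lambda>\<^sub>+\<^sup>N A\<^sub>+\<^sup>K\<close> times a double sum over \<open>k\<close> and \<open>l\<close> of nonnegative terms with the factor
  \<open>(a r\<^sup>2)\<^sup>k r\<^sup>l\<close>, where \<open>2 k\<close> of the \<open>2 K\<close> vertices of degree 1 and \<open>l\<close> of the vertices of degree 2
  contribute \<open>Y\<close> instead of \<open>X\<close>.

  By Stirling's formula the term with \<open>k = s N\<close> and \<open>l = t N\<close> is \<open>exp (N H(s, t))\<close> up to a factor that
  is polynomial in \<open>N\<close>, and there are only polynomially many terms. So the double sum grows like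
  \<open>exp (N max H)\<close> if \<open>B \<noteq> 0\<close> (\<open>gauss_sum_exponential_rate\<close>). The maximum point is unique since \<open>H\<close> is
  strictly concave: its entropic part is a sum of mixing entropies, which are superadditive and
  homogeneous.

  For \<open>B = 0\<close>, where \<open>a = 0\<close>, the maximum is \<open>0\<close> and is attained at the origin. Gibbs' inequality
  gives \<open>0 \<le> max H \<le> (1 - p) / 2 * a r\<^sup>2\<close> for all \<open>B\<close>, and the right-hand side vanishes together
  with its derivative at \<open>B = 0\<close>. Hence \<open>max H\<close> is differentiable there, with derivative \<open>0\<close>. The limit of
  the pressure at \<open>B = 0\<close> follows from the one for \<open>B \<noteq> 0\<close>, because the pressures of finite size are
  Lipschitz in \<open>B\<close> with constant \<open>1\<close>.

  For the magnetization, Jensen's inequality shows that the magnetization at \<open>B\<close> is a subgradient of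
  the pressure of the same size (\<open>annealed_pressure_subgradient\<close>). Subgradients converge to the
  derivative of the limit wherever the limit is differentiable. For \<open>B \<noteq> 0\<close> that derivative comes from
  the envelope theorem: since the maximum point is unique, \<open>max H\<close> may be differentiated with
  \<open>(s, t)\<close> kept at the maximum point.
\<close>

section \<open>Pairings and Gaussian moments\<close>

text \<open>
  The moments of a standard Gaussian variable, which are also the numbers of pairings of a
  \<open>j\<close>-element set.
\<close>

fun gauss_moment :: "nat \<Rightarrow> real" where
  "gauss_moment 0 = 1"
| "gauss_moment (Suc 0) = 0"
| "gauss_moment (Suc (Suc j)) = real (Suc j) * gauss_moment j"

lemma gauss_moment_even: "gauss_moment (2 * i) = fact (2 * i) / (2 ^ i * fact i)"
proof (induction i)
  case (Suc i)
  have "gauss_moment (2 * Suc i) = real (2 * i + 1) * gauss_moment (2 * i)" by simp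
  also have "\<dots> = fact (2 * Suc i) / (2 ^ Suc i * fact (Suc i))"
    unfolding Suc.IH by (simp add: divide_simps)
  finally show ?case .
qed simp

lemma gauss_moment_odd: "odd j \<Longrightarrow> gauss_moment j = 0"
  by (induction j rule: gauss_moment.induct) auto

text \<open>
  A polynomial \<open>q\<close> stands for the form \<open>\<Sum>j. coeff q j * X ^ (M - j) * Y ^ j\<close> of degree \<open>M\<close>, and
  \<open>wick M q\<close> is the expectation of that form for independent standard Gaussian \<open>X\<close> and \<open>Y\<close>. Setting
  \<open>X = 1\<close> in this way allows univariate polynomials to be used throughout.
\<close>

definition wick :: "nat \<Rightarrow> real poly \<Rightarrow> real" where
  "wick M q = (\<Sum>j\<le>M. coeff q j * gauss_moment j * gauss_moment (M - j))"

lemma wick_0 [simp]: "wick M 0 = 0"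
  and wick_add: "wick M (q + q') = wick M q + wick M q'"
  and wick_smult: "wick M (smult c q) = c * wick M q"
  by (simp_all add: wick_def sum.distrib sum_distrib_left algebra_simps)

lemma wick_sum: "wick M (\<Sum>i\<in>I. q i) = (\<Sum>i\<in>I. wick M (q i))"
  by (induction I rule: infinite_finite_induct) (simp_all add: wick_add)

lemma wick_monom:
  "j \<le> M \<Longrightarrow> wick M (monom c j) = c * gauss_moment j * gauss_moment (M - j)"
  by (simp add: wick_def if_distrib[of "\<lambda>x. x * _"] cong: if_cong)

text \<open>
  Gaussian integration by parts in the second variable: the expectation of \<open>Y * f\<close> is that of
  \<open>\<partial>f / \<partial>Y\<close>.
\<close>

lemma wick_pCons_0: "wick (Suc (Suc M)) (pCons 0 q) = wick M (pderiv q)"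
proof -
  have "wick (Suc (Suc M)) (pCons 0 q) =
    (\<Sum>j\<le>Suc M. coeff q j * gauss_moment (Suc j) * gauss_moment (Suc M - j))"
    unfolding wick_def by (subst sum.atMost_Suc_shift) simp
  also have "\<dots> = wick M (pderiv q)"
    unfolding wick_def by (subst sum.atMost_Suc_shift) (simp add: coeff_pderiv algebra_simps)
  finally show ?thesis .
qed

text \<open>
  Gaussian integration by parts in the first variable: on the left \<open>q\<close> stands for \<open>X * f\<close> with a form
  \<open>f\<close> of degree \<open>M + 1\<close>, and on the right is \<open>\<partial>f / \<partial>X\<close>. Euler's identity
  \<open>X * \<partial>f / \<partial>X = (M + 1) * f - Y * \<partial>f / \<partial>Y\<close> expresses this derivative through the dehomogenized
  polynomial.
\<close>

lemma wick_Suc_Suc: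
  assumes "degree q \<le> Suc M"
  shows "wick (Suc (Suc M)) q = wick M (smult (real (Suc M)) q - pCons 0 (pderiv q))"
proof -
  have co: "coeff (pCons 0 (pderiv q)) j = real j * coeff q j" for j
    by (cases j) (simp_all add: coeff_pderiv)
  have "wick (Suc (Suc M)) q =
    (\<Sum>j\<le>M. coeff q j * gauss_moment j * gauss_moment (Suc (Suc M) - j))"
    using assms by (simp add: wick_def coeff_eq_0)
  also have "\<dots> = wick M (smult (real (Suc M)) q - pCons 0 (pderiv q))"
    unfolding wick_def coeff_diff coeff_smult co
  proof (rule sum.cong)
    fix j assume "j \<in> {..M}"
    hence "Suc (Suc M) - j = Suc (Suc (M - j))" "real (Suc (M - j)) = real (Suc M) - real j"
      by auto
    thus "coeff q j * gauss_moment j * gauss_moment (Suc (Suc M) - j) =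
      (real (Suc M) * coeff q j - real j * coeff q j) * gauss_moment j * gauss_moment (M - j)"
      by (simp add: algebra_simps)
  qed simp
  finally show ?thesis .
qed

text \<open>
  The recursion of Wick's formula. Integrating by parts with respect to the form of index \<open>h\<close>
  differentiates each other form in turn, which produces the covariance of the forms of index
  \<open>h\<close> and \<open>h'\<close>.
\<close>

lemma wick_linear_prod:
  fixes u v :: "'a \<Rightarrow> real"
  assumes "finite A" "h \<notin> A"
  shows "wick (card (insert h A)) (\<Prod>i\<in>insert h A. [:u i, v i:])
       = (\<Sum>h'\<in>A. (u h * u h' + v h * v h') * wick (card A - 1) (\<Prod>i\<in>A - {h'}. [:u i, v i:]))"
proof (cases "card A")
  case 0
  hence "A = {}" using assms by simp
  thus ?thesis by (simp add: wick_def)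
next
  case (Suc M)
  define Q where "Q = (\<Prod>i\<in>A. [:u i, v i:])"
  define R where "R = (\<lambda>h'. \<Prod>i\<in>A - {h'}. [:u i, v i:])"
  have QR: "Q = [:u h', v h':] * R h'" if "h' \<in> A" for h'
    unfolding Q_def R_def using that assms(1) by (rule prod.remove[rotated])
  have dQ: "pderiv Q = (\<Sum>h'\<in>A. smult (v h') (R h'))"
    unfolding Q_def R_def pderiv_prod by (simp add: pderiv_pCons)
  have "degree Q \<le> (\<Sum>i\<in>A. degree [:u i, v i:])"
    unfolding Q_def by (rule degree_prod_sum_le[OF assms(1), unfolded o_def])
  also have "\<dots> \<le> (\<Sum>i\<in>A. 1)" by (intro sum_mono) simp
  finally have deg: "degree Q \<le> Suc M" using Suc by simp
  have "smult (real (Suc M)) Q - pCons 0 (pderiv Q) = (\<Sum>h'\<in>A. Q - smult (v h') (pCons 0 (R h')))"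
  proof -
    have "pCons 0 (\<Sum>h'\<in>A. smult (v h') (R h')) = (\<Sum>h'\<in>A. smult (v h') (pCons 0 (R h')))"
      by (rule poly_eqI) (simp add: coeff_pCons coeff_sum split: nat.split)
    moreover have "smult (real (Suc M)) Q = (\<Sum>h'\<in>A. Q)"
      by (simp add: Suc of_nat_poly)
    ultimately show ?thesis by (simp add: dQ sum_subtractf)
  qed
  also have "\<dots> = (\<Sum>h'\<in>A. smult (u h') (R h'))"
    by (rule sum.cong) (simp_all add: QR)
  finally have E: "smult (real (Suc M)) Q - pCons 0 (pderiv Q) = (\<Sum>h'\<in>A. smult (u h') (R h'))" .
  have "wick (card (insert h A)) (\<Prod>i\<in>insert h A. [:u i, v i:]) =
      wick (Suc (Suc M)) (smult (u h) Q + smult (v h) (pCons 0 Q))"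
    using assms Suc by (simp add: Q_def)
  also have "\<dots> = u h * wick M (\<Sum>h'\<in>A. smult (u h') (R h'))
                 + v h * wick M (\<Sum>h'\<in>A. smult (v h') (R h'))"
    unfolding wick_add wick_smult wick_pCons_0 wick_Suc_Suc[OF deg] E
    unfolding dQ ..
  also have "\<dots> = (\<Sum>h'\<in>A. (u h * u h' + v h * v h') * wick M (R h'))"
    by (simp add: wick_sum wick_smult sum_distrib_left sum.distrib algebra_simps)
  finally show ?thesis using Suc by (simp add: R_def)
qed

lemma pairings_empty [simp]: "pairings {} = {{}}"
  by (auto simp: pairings_def partition_on_empty)

lemma finite_pairings: "finite A \<Longrightarrow> finite (pairings A)"
  unfolding pairings_def using finitely_many_partition_on[of A] by auto

lemma finite_pairing: "finite A \<Longrightarrow> P \<in> pairings A \<Longrightarrow> finite P"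
  unfolding pairings_def using finite_elements by blast

text \<open>
  A pairing of \<open>insert h A\<close> is determined by the partner \<open>h'\<close> of \<open>h\<close> and a pairing of the remaining
  elements.
\<close>

lemma bij_betw_pairings_insert:
  assumes "h \<notin> A"
  shows "bij_betw (\<lambda>(h', P). insert {h, h'} P) (SIGMA h':A. pairings (A - {h'}))
           (pairings (insert h A))"
proof (rule bij_betw_imageI)
  have sub: "\<Union>P = A - {h'}" if "P \<in> pairings (A - {h'})" for P h'
    using that by (auto simp: pairings_def partition_on_def)
  show "inj_on (\<lambda>(h', P). insert {h, h'} P) (SIGMA h':A. pairings (A - {h'}))"
  proof (rule inj_onI, clarify)
    fix x P y P'
    assume x: "x \<in> A" "P \<in> pairings (A - {x})" and y: "y \<in> A" "P' \<in> pairings (A - {y})"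
      and eq: "insert {h, x} P = insert {h, y} P'"
    have nP: "{h, z} \<notin> P" "{h, z} \<notin> P'" for z using sub[OF x(2)] sub[OF y(2)] assms by blast+
    hence "{h, x} = {h, y}" using eq by blast
    hence "x = y" using x y assms by (auto simp: doubleton_eq_iff)
    thus "x = y \<and> P = P'" using eq nP by (metis insert_ident)
  qed
  show "(\<lambda>(h', P). insert {h, h'} P) ` (SIGMA h':A. pairings (A - {h'})) = pairings (insert h A)"
  proof (intro equalityI subsetI)
    fix Q assume "Q \<in> (\<lambda>(h', P). insert {h, h'} P) ` (SIGMA h':A. pairings (A - {h'}))"
    then obtain x P where x: "x \<in> A" "P \<in> pairings (A - {x})" and Q: "Q = insert {h, x} P" by auto
    have "h \<noteq> x" using x assms by auto
    thus "Q \<in> pairings (insert h A)"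
      using x sub[OF x(2)] assms
      by (auto simp: Q pairings_def partition_on_def disjoint_insert pairwise_insert disjnt_def)
  next
    fix Q assume Q: "Q \<in> pairings (insert h A)"
    then obtain e where e: "e \<in> Q" "h \<in> e" by (auto simp: pairings_def partition_on_def)
    have "card e = 2" using Q e by (auto simp: pairings_def)
    then obtain x where ex: "e = {h, x}" "x \<noteq> h" using e(2) by (auto simp: card_2_iff)
    have xA: "x \<in> A" using Q e ex by (auto simp: pairings_def partition_on_def)
    have dis: "f \<inter> e = {}" if "f \<in> Q" "f \<noteq> e" for f
      using Q e that by (auto simp: pairings_def partition_on_def disjoint_def)
    have "\<Union>(Q - {e}) = A - {x}"
    proof -
      have "\<Union>Q = insert h A" using Q by (auto simp: pairings_def partition_on_def)
      moreover have "\<Union>Q = e \<union> \<Union>(Q - {e})" using e by blast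
      moreover have "e \<inter> \<Union>(Q - {e}) = {}" using dis by blast
      ultimately have "\<Union>(Q - {e}) = insert h A - e" by (metis Diff_triv Int_commute Un_Diff Diff_cancel Un_empty_left)
      thus ?thesis using ex(1) assms by simp
    qed
    moreover have "disjoint Q" "{} \<notin> Q" "\<forall>f\<in>Q. card f = 2"
      using Q by (simp_all add: pairings_def partition_on_def)
    moreover from this have "disjoint (Q - {e})"
      by (auto intro: pairwise_subset)
    ultimately have "Q - {e} \<in> pairings (A - {x})"
      by (simp add: pairings_def partition_on_def)
    moreover have "Q = insert {h, x} (Q - {e})" using e ex by blast
    ultimately show "Q \<in> (\<lambda>(h', P). insert {h, h'} P) ` (SIGMA h':A. pairings (A - {h'}))"
      using xA by (intro image_eqI[of _ _ "(x, Q - {e})"]) auto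
  qed
qed

lemma sum_pairings_insert:
  fixes w :: "'a set \<Rightarrow> real"
  assumes "finite A" "h \<notin> A"
  shows "(\<Sum>P\<in>pairings (insert h A). \<Prod>e\<in>P. w e) =
    (\<Sum>h'\<in>A. w {h, h'} * (\<Sum>P\<in>pairings (A - {h'}). \<Prod>e\<in>P. w e))"
proof -
  have "(\<Sum>P\<in>pairings (insert h A). \<Prod>e\<in>P. w e) =
      (\<Sum>(h', P)\<in>(SIGMA h':A. pairings (A - {h'})). \<Prod>e\<in>insert {h, h'} P. w e)"
    using sum.reindex_bij_betw[OF bij_betw_pairings_insert[OF assms(2)], of "\<lambda>P. \<Prod>e\<in>P. w e"]
    by (simp add: case_prod_unfold)
  also have "\<dots> = (\<Sum>h'\<in>A. \<Sum>P\<in>pairings (A - {h'}). \<Prod>e\<in>insert {h, h'} P. w e)"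
    using assms by (subst sum.Sigma) (auto intro: finite_pairings)
  also have "\<dots> = (\<Sum>h'\<in>A. \<Sum>P\<in>pairings (A - {h'}). w {h, h'} * (\<Prod>e\<in>P. w e))"
  proof (intro sum.cong refl)
    fix h' P assume P: "P \<in> pairings (A - {h'})"
    hence "{h, h'} \<notin> P" using assms(2) by (auto simp: pairings_def partition_on_def)
    moreover have "finite P" using finite_pairing[OF _ P] assms(1) by auto
    ultimately show "(\<Prod>e\<in>insert {h, h'} P. w e) = w {h, h'} * (\<Prod>e\<in>P. w e)" by simp
  qed
  finally show ?thesis by (simp add: sum_distrib_left)
qed

text \<open>
  Wick's formula. Both sides satisfy the same recursion when an element is removed from \<open>A\<close>.
\<close>

theorem sum_pairings_eq_wick:
  fixes u v :: "'a \<Rightarrow> real" and w :: "'a set \<Rightarrow> real"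
  assumes "finite A"
    and "\<And>h h'. h \<in> A \<Longrightarrow> h' \<in> A \<Longrightarrow> h \<noteq> h' \<Longrightarrow> w {h, h'} = u h * u h' + v h * v h'"
  shows "(\<Sum>P\<in>pairings A. \<Prod>e\<in>P. w e) = wick (card A) (\<Prod>h\<in>A. [:u h, v h:])"
  using assms
proof (induction "card A" arbitrary: A rule: less_induct)
  case less
  show ?case
  proof (cases "A = {}")
    case True thus ?thesis by (simp add: wick_def)
  next
    case False
    then obtain h A' where A: "A = insert h A'" "h \<notin> A'" by (meson mk_disjoint_insert ex_in_conv)
    have fin: "finite A'" using less.prems A by simp
    have "(\<Sum>P\<in>pairings A. \<Prod>e\<in>P. w e) =
        (\<Sum>h'\<in>A'. w {h, h'} * (\<Sum>P\<in>pairings (A' - {h'}). \<Prod>e\<in>P. w e))"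
      unfolding A by (rule sum_pairings_insert[OF fin A(2)])
    also have "\<dots> = (\<Sum>h'\<in>A'. (u h * u h' + v h * v h') *
        wick (card A' - 1) (\<Prod>i\<in>A' - {h'}. [:u i, v i:]))"
    proof (intro sum.cong refl)
      fix h' assume h': "h' \<in> A'"
      have "card (A' - {h'}) < card A" using A fin by (simp add: le_imp_less_Suc card_Diff1_le)
      hence "(\<Sum>P\<in>pairings (A' - {h'}). \<Prod>e\<in>P. w e) =
          wick (card (A' - {h'})) (\<Prod>i\<in>A' - {h'}. [:u i, v i:])"
        using fin A less.prems by (intro less.hyps) auto
      moreover have "w {h, h'} = u h * u h' + v h * v h'"
        using h' A less.prems(2)[of h h'] by auto
      ultimately show "w {h, h'} * (\<Sum>P\<in>pairings (A' - {h'}). \<Prod>e\<in>P. w e) =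
          (u h * u h' + v h * v h') * wick (card A' - 1) (\<Prod>i\<in>A' - {h'}. [:u i, v i:])"
        using h' fin by simp
    qed
    also have "\<dots> = wick (card A) (\<Prod>h\<in>A. [:u h, v h:])"
      unfolding A by (rule wick_linear_prod[OF fin A(2), symmetric])
    finally show ?thesis .
  qed
qed

lemma card_pairings: "finite A \<Longrightarrow> real (card (pairings A)) = gauss_moment (card A)"
  using sum_pairings_eq_wick[of A "\<lambda>_. 1" "\<lambda>_. 1" "\<lambda>_. 0"] wick_monom[of 0 "card A" 1]
  by (simp add: monom_0 flip: one_pCons)

section \<open>Diagonalizing the transfer matrix\<close>

text \<open>
  The transfer matrix has the diagonal entries \<open>exp (\<beta> + B)\<close> and \<open>exp (\<beta> - B)\<close> and the off-diagonal
  entries \<open>exp (- \<beta>)\<close>. Its eigenvalues are \<open>lam_plus\<close> and \<open>lam_minus\<close>, with the orthogonal eigenvectors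
  \<open>(exp (- \<beta>), x)\<close> and \<open>(x, - exp (- \<beta>))\<close> for \<open>x = shifted_eigenvalue \<beta> B\<close>.
\<close>

definition shifted_eigenvalue :: "real \<Rightarrow> real \<Rightarrow> real" where
  "shifted_eigenvalue \<beta> B = lam_plus \<beta> B - exp (\<beta> + B)"

definition eigvec_norm2 :: "real \<Rightarrow> real \<Rightarrow> real" where
  "eigvec_norm2 \<beta> B = exp (- 2 * \<beta>) + (shifted_eigenvalue \<beta> B)\<^sup>2"

text \<open>
  The entries of the two normalized eigenvectors, each scaled by the root of the eigenvalue and divided
  by \<open>exp (B * \<sigma> / 2)\<close>. The last factor turns the spectral decomposition of the transfer matrix into
  one of the kernel \<open>exp (\<beta> * \<sigma> * \<tau>)\<close>.
\<close>

definition eig_u :: "real \<Rightarrow> real \<Rightarrow> real \<Rightarrow> real" where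
  "eig_u \<beta> B \<sigma> = sqrt (lam_plus \<beta> B / eigvec_norm2 \<beta> B) *
     (if \<sigma> = 1 then exp (- \<beta>) * exp (- B / 2) else shifted_eigenvalue \<beta> B * exp (B / 2))"

definition eig_v :: "real \<Rightarrow> real \<Rightarrow> real \<Rightarrow> real" where
  "eig_v \<beta> B \<sigma> = sqrt (lam_minus \<beta> B / eigvec_norm2 \<beta> B) *
     (if \<sigma> = 1 then shifted_eigenvalue \<beta> B * exp (- B / 2) else - exp (- \<beta>) * exp (B / 2))"

lemma lam_plus_pos: "lam_plus \<beta> B > 0"
  using lam_plus_gt[of \<beta> B] exp_gt_zero[of "\<beta> + B"] by linarith

text \<open>
  Everything that is needed about the eigenvectors, as polynomial relations between a few abstract
  quantities, so that the identities below become ideal membership problems. Here \<open>g\<close> and \<open>g'\<close>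
  are \<open>exp (B / 2)\<close> and its inverse, and \<open>P\<close> and \<open>Q\<close> are the normalizing factors.
\<close>

lemma eigen_relations:
  assumes "\<beta> > 0"
  obtains b e g g' x \<nu> P Q where
    "b * e = 1" "g * g' = 1" "\<nu> > 0" "\<nu> = e\<^sup>2 + x\<^sup>2"
    "lam_plus \<beta> B = x + b * g\<^sup>2" "lam_minus \<beta> B = b * g'\<^sup>2 - x"
    "x * (x + b * g\<^sup>2 - b * g'\<^sup>2) = e\<^sup>2" "P\<^sup>2 * \<nu> = lam_plus \<beta> B" "Q\<^sup>2 * \<nu> = lam_minus \<beta> B"
    "exp \<beta> = b" "exp (- \<beta>) = e" "exp B = g\<^sup>2" "exp (- B) = g'\<^sup>2"
    "eig_u \<beta> B 1 = P * (e * g')" "eig_u \<beta> B (-1) = P * (x * g)"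
    "eig_v \<beta> B 1 = Q * (x * g')" "eig_v \<beta> B (-1) = - Q * (e * g)"
    "shifted_eigenvalue \<beta> B = x" "exp (- 2 * \<beta>) = e\<^sup>2"
proof -
  define x where "x = shifted_eigenvalue \<beta> B"
  define \<nu> where "\<nu> = eigvec_norm2 \<beta> B"
  have g: "exp B = (exp (B / 2))\<^sup>2" "exp (- B) = (exp (- B / 2))\<^sup>2" "exp (- 2 * \<beta>) = (exp (- \<beta>))\<^sup>2"
    by (simp_all flip: exp_double)
  have \<nu>: "\<nu> > 0" by (simp add: \<nu>_def eigvec_norm2_def add_pos_nonneg)
  have \<nu>': "\<nu> = (exp (- \<beta>))\<^sup>2 + x\<^sup>2" by (simp only: \<nu>_def x_def eigvec_norm2_def g)
  have e: "exp (\<beta> + B) = exp \<beta> * (exp (B / 2))\<^sup>2" "exp (\<beta> - B) = exp \<beta> * (exp (- B / 2))\<^sup>2"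
    by (simp_all flip: exp_double exp_add)
  have lp: "lam_plus \<beta> B = x + exp \<beta> * (exp (B / 2))\<^sup>2"
    by (simp add: x_def shifted_eigenvalue_def e)
  have "lam_plus \<beta> B + lam_minus \<beta> B = exp (\<beta> + B) + exp (\<beta> - B)"
    unfolding lam_plus_def lam_minus_def by (simp add: cosh_def exp_add exp_diff exp_minus field_simps)
  hence lm: "lam_minus \<beta> B = exp \<beta> * (exp (- B / 2))\<^sup>2 - x"
    using lp e by linarith
  have "x * (x + exp (\<beta> + B) - exp (\<beta> - B)) = exp (- 2 * \<beta>)"
    using lam_plus_char[of \<beta> B] by (simp add: x_def shifted_eigenvalue_def algebra_simps)
  hence ch: "x * (x + exp \<beta> * (exp (B / 2))\<^sup>2 - exp \<beta> * (exp (- B / 2))\<^sup>2) = (exp (- \<beta>))\<^sup>2"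
    by (simp only: e g)
  show ?thesis
  proof (rule that[of "exp \<beta>" "exp (- \<beta>)" "exp (B / 2)" "exp (- B / 2)" \<nu> x
        "sqrt (lam_plus \<beta> B / \<nu>)" "sqrt (lam_minus \<beta> B / \<nu>)"])
  qed (use \<nu> \<nu>' lp lm ch g lam_plus_pos[of \<beta> B] lam_minus_pos[OF assms, of B] in
      \<open>simp_all add: eig_u_def eig_v_def x_def [symmetric] \<nu>_def [symmetric] flip: exp_add\<close>)
qed

text \<open>
  The spectral decomposition of the transfer matrix, with the factors \<open>exp (B * \<sigma> / 2)\<close> removed.
\<close>

lemma eig_edge:
  assumes "\<beta> > 0" "\<sigma> \<in> {-1, 1}" "\<tau> \<in> {-1, 1}"
  shows "eig_u \<beta> B \<sigma> * eig_u \<beta> B \<tau> + eig_v \<beta> B \<sigma> * eig_v \<beta> B \<tau> = exp (\<beta> * (\<sigma> * \<tau>))"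
proof -
  obtain b e g g' x \<nu> P Q where r: "b * e = 1" "g * g' = 1" "\<nu> > 0" "\<nu> = e\<^sup>2 + x\<^sup>2"
    "lam_plus \<beta> B = x + b * g\<^sup>2" "lam_minus \<beta> B = b * g'\<^sup>2 - x"
    "x * (x + b * g\<^sup>2 - b * g'\<^sup>2) = e\<^sup>2" "P\<^sup>2 * \<nu> = lam_plus \<beta> B" "Q\<^sup>2 * \<nu> = lam_minus \<beta> B"
    and s: "exp \<beta> = b" "exp (- \<beta>) = e"
    "eig_u \<beta> B 1 = P * (e * g')" "eig_u \<beta> B (-1) = P * (x * g)"
    "eig_v \<beta> B 1 = Q * (x * g')" "eig_v \<beta> B (-1) = - Q * (e * g)"
    by (rule eigen_relations[OF assms(1), of B]) blast
  have "\<nu> * ((P * (e * g')) * (P * (e * g')) + (Q * (x * g')) * (Q * (x * g'))) = \<nu> * b"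
    using r(1,2,4-9) by algebra
  moreover have "\<nu> * ((P * (e * g')) * (P * (x * g)) + (Q * (x * g')) * (- Q * (e * g))) = \<nu> * e"
    using r(1,2,4-9) by algebra
  moreover have "\<nu> * ((P * (x * g)) * (P * (x * g)) + (- Q * (e * g)) * (- Q * (e * g))) = \<nu> * b"
    using r(1,2,4-9) by algebra
  ultimately have "(P * (e * g')) * (P * (e * g')) + (Q * (x * g')) * (Q * (x * g')) = b"
    "(P * (e * g')) * (P * (x * g)) + (Q * (x * g')) * (- Q * (e * g)) = e"
    "(P * (x * g)) * (P * (x * g)) + (- Q * (e * g)) * (- Q * (e * g)) = b"
    using r(3) by simp_all
  thus ?thesis using assms(2,3) by (auto simp: s mult.commute)
qed

definition vertex1_u :: "real \<Rightarrow> real \<Rightarrow> real" where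
  "vertex1_u \<beta> B = (\<Sum>\<sigma>\<in>{-1, 1}. exp (B * \<sigma>) * eig_u \<beta> B \<sigma>)"

definition vertex1_v :: "real \<Rightarrow> real \<Rightarrow> real" where
  "vertex1_v \<beta> B = (\<Sum>\<sigma>\<in>{-1, 1}. exp (B * \<sigma>) * eig_v \<beta> B \<sigma>)"

lemma vertex_factor_1:
  "(\<Sum>\<sigma>\<in>{-1, 1}. smult (exp (B * \<sigma>)) [:eig_u \<beta> B \<sigma>, eig_v \<beta> B \<sigma>:]) =
     [:vertex1_u \<beta> B, vertex1_v \<beta> B:]"
  by (simp add: vertex1_u_def vertex1_v_def)

text \<open>
  The mixed coefficient vanishes because the eigenvectors are orthogonal. This is why they are the
  right choice among all the factorizations of the edge weight.
\<close>

lemma vertex_factor_2: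
  assumes "\<beta> > 0"
  shows "(\<Sum>\<sigma>\<in>{-1, 1}. smult (exp (B * \<sigma>)) ([:eig_u \<beta> B \<sigma>, eig_v \<beta> B \<sigma>:]\<^sup>2)) =
     [:lam_plus \<beta> B, 0, lam_minus \<beta> B:]"
proof -
  obtain b e g g' x \<nu> P Q where r: "b * e = 1" "g * g' = 1" "\<nu> > 0" "\<nu> = e\<^sup>2 + x\<^sup>2"
    "lam_plus \<beta> B = x + b * g\<^sup>2" "lam_minus \<beta> B = b * g'\<^sup>2 - x"
    "x * (x + b * g\<^sup>2 - b * g'\<^sup>2) = e\<^sup>2" "P\<^sup>2 * \<nu> = lam_plus \<beta> B" "Q\<^sup>2 * \<nu> = lam_minus \<beta> B"
    and s: "exp B = g\<^sup>2" "exp (- B) = g'\<^sup>2"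
    "eig_u \<beta> B 1 = P * (e * g')" "eig_u \<beta> B (-1) = P * (x * g)"
    "eig_v \<beta> B 1 = Q * (x * g')" "eig_v \<beta> B (-1) = - Q * (e * g)"
    by (rule eigen_relations[OF assms(1), of B]) blast
  have 1: "g'\<^sup>2 * (P * (x * g))\<^sup>2 + g\<^sup>2 * (P * (e * g'))\<^sup>2 = lam_plus \<beta> B"
    using r(2,4,8) by algebra
  have 2: "g'\<^sup>2 * (- Q * (e * g))\<^sup>2 + g\<^sup>2 * (Q * (x * g'))\<^sup>2 = lam_minus \<beta> B"
    using r(2,4,9) by algebra
  have 3: "g'\<^sup>2 * ((P * (x * g)) * (- Q * (e * g))) + g\<^sup>2 * ((P * (e * g')) * (Q * (x * g'))) = 0"
    by (simp add: power2_eq_square)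
  show ?thesis using 1 2 3
    by (simp add: s power2_eq_square algebra_simps)
qed

lemma vertex1_squares:
  assumes "\<beta> > 0"
  shows "(vertex1_u \<beta> B)\<^sup>2 = A_plus \<beta> B * (lam_plus \<beta> B)\<^sup>2"
    and "(vertex1_v \<beta> B)\<^sup>2 = A_minus \<beta> B * (lam_minus \<beta> B)\<^sup>2"
proof -
  obtain b e g g' x \<nu> P Q where r: "b * e = 1" "g * g' = 1" "\<nu> > 0" "\<nu> = e\<^sup>2 + x\<^sup>2"
    "P\<^sup>2 * \<nu> = lam_plus \<beta> B" "Q\<^sup>2 * \<nu> = lam_minus \<beta> B"
    and s: "exp B = g\<^sup>2" "exp (- B) = g'\<^sup>2" "exp (- \<beta>) = e"
    "eig_u \<beta> B 1 = P * (e * g')" "eig_u \<beta> B (-1) = P * (x * g)"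
    "eig_v \<beta> B 1 = Q * (x * g')" "eig_v \<beta> B (-1) = - Q * (e * g)"
    "shifted_eigenvalue \<beta> B = x" "exp (- 2 * \<beta>) = e\<^sup>2"
    by (rule eigen_relations[OF assms(1), of B]) blast
  note sh = s(8)[unfolded shifted_eigenvalue_def]
  have l: "lam_plus \<beta> B > 0" "lam_minus \<beta> B > 0"
    using lam_plus_pos lam_minus_pos[OF assms] by auto
  have Ap: "A_plus \<beta> B * (\<nu> * lam_plus \<beta> B) = e\<^sup>2 * g\<^sup>2 + x\<^sup>2 * g'\<^sup>2 + 2 * e * x"
    unfolding A_plus_def sh s r(4)[symmetric] using r(3) l by simp
  have Am: "A_minus \<beta> B * (\<nu> * lam_minus \<beta> B) = e\<^sup>2 * g'\<^sup>2 + x\<^sup>2 * g\<^sup>2 - 2 * e * x"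
    unfolding A_minus_def sh s r(4)[symmetric] using r(3) l by simp
  have "vertex1_u \<beta> B = P * (e * g + x * g')"
    unfolding vertex1_u_def by (simp add: s) (use r(2) in algebra)
  hence "\<nu> * (vertex1_u \<beta> B)\<^sup>2 = \<nu> * (A_plus \<beta> B * (lam_plus \<beta> B)\<^sup>2)"
    using Ap r(2,5) by algebra
  thus "(vertex1_u \<beta> B)\<^sup>2 = A_plus \<beta> B * (lam_plus \<beta> B)\<^sup>2" using r(3) by simp
  have "vertex1_v \<beta> B = Q * (x * g - e * g')"
    unfolding vertex1_v_def by (simp add: s) (use r(2) in algebra)
  hence "\<nu> * (vertex1_v \<beta> B)\<^sup>2 = \<nu> * (A_minus \<beta> B * (lam_minus \<beta> B)\<^sup>2)"
    using Am r(2,6) by algebra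
  thus "(vertex1_v \<beta> B)\<^sup>2 = A_minus \<beta> B * (lam_minus \<beta> B)\<^sup>2" using r(3) by simp
qed

section \<open>The exact formula for the annealed partition function\<close>

lemma spin_configs_values: "\<sigma> \<in> spin_configs N \<Longrightarrow> i \<in> {1..N} \<Longrightarrow> \<sigma> i \<in> {-1, 1}"
  unfolding spin_configs_def by (rule PiE_mem)

lemma finite_spin_configs: "finite (spin_configs N)"
  unfolding spin_configs_def by (intro finite_PiE) auto

lemma finite_half_edges: "finite (half_edges N d)"
  by (simp add: half_edges_def)

lemma card_half_edges: "card (half_edges N d) = (\<Sum>i\<in>{1..N}. d i)"
  by (simp add: half_edges_def)

lemma boltzmann_weight_pairing_edges:
  "boltzmann_weight N \<beta> B (pairing_edges P) \<sigma> =
    exp (B * total_spin N \<sigma>) * (\<Prod>e\<in>P. exp (\<beta> * (\<Prod>h\<in>e. \<sigma> (fst h))))" if "finite P"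
proof -
  have "(\<Sum>e\<in>#pairing_edges P. \<Prod>i\<in>#e. \<sigma> i) = (\<Sum>e\<in>P. \<Prod>h\<in>e. \<sigma> (fst h))"
    unfolding pairing_edges_def
    by (simp add: image_mset.compositionality comp_def sum_unfold_sum_mset prod_unfold_prod_mset)
  thus ?thesis
    using that by (simp add: boltzmann_weight_def exp_add exp_sum sum_distrib_left)
qed

lemma sum_boltzmann_over_pairings:
  assumes "\<beta> > 0" "\<sigma> \<in> spin_configs N"
  shows "(\<Sum>P\<in>pairings (half_edges N d). boltzmann_weight N \<beta> B (pairing_edges P) \<sigma>) =
    wick (card (half_edges N d))
      (\<Prod>i\<in>{1..N}. smult (exp (B * \<sigma> i)) ([:eig_u \<beta> B (\<sigma> i), eig_v \<beta> B (\<sigma> i):] ^ d i))"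
proof -
  have "(\<Sum>P\<in>pairings (half_edges N d). boltzmann_weight N \<beta> B (pairing_edges P) \<sigma>) =
      exp (B * total_spin N \<sigma>) *
        (\<Sum>P\<in>pairings (half_edges N d). \<Prod>e\<in>P. exp (\<beta> * (\<Prod>h\<in>e. \<sigma> (fst h))))"
    unfolding sum_distrib_left
    by (intro sum.cong refl boltzmann_weight_pairing_edges finite_pairing[OF finite_half_edges])
  also have "(\<Sum>P\<in>pairings (half_edges N d). \<Prod>e\<in>P. exp (\<beta> * (\<Prod>h\<in>e. \<sigma> (fst h)))) =
      wick (card (half_edges N d))
        (\<Prod>h\<in>half_edges N d. [:eig_u \<beta> B (\<sigma> (fst h)), eig_v \<beta> B (\<sigma> (fst h)):])"
  proof (rule sum_pairings_eq_wick[OF finite_half_edges])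
    fix h h' assume h: "h \<in> half_edges N d" "h' \<in> half_edges N d" "h \<noteq> h'"
    hence "fst h \<in> {1..N}" "fst h' \<in> {1..N}" by (auto simp: half_edges_def)
    thus "exp (\<beta> * (\<Prod>h\<in>{h, h'}. \<sigma> (fst h))) =
        eig_u \<beta> B (\<sigma> (fst h)) * eig_u \<beta> B (\<sigma> (fst h')) + eig_v \<beta> B (\<sigma> (fst h)) * eig_v \<beta> B (\<sigma> (fst h'))"
      using h spin_configs_values[OF assms(2)] by (subst eig_edge[OF assms(1)]) auto
  qed
  also have "(\<Prod>h\<in>half_edges N d. [:eig_u \<beta> B (\<sigma> (fst h)), eig_v \<beta> B (\<sigma> (fst h)):]) =
      (\<Prod>i\<in>{1..N}. [:eig_u \<beta> B (\<sigma> i), eig_v \<beta> B (\<sigma> i):] ^ d i)"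
    unfolding half_edges_def
    by (subst prod.Sigma[of "{1..N}" "\<lambda>i. {..<d i}" "\<lambda>i _. [:eig_u \<beta> B (\<sigma> i), eig_v \<beta> B (\<sigma> i):]",
          symmetric, simplified case_prod_unfold]) auto
  also have "exp (B * total_spin N \<sigma>) * wick (card (half_edges N d)) \<dots> =
      wick (card (half_edges N d))
      (\<Prod>i\<in>{1..N}. smult (exp (B * \<sigma> i)) ([:eig_u \<beta> B (\<sigma> i), eig_v \<beta> B (\<sigma> i):] ^ d i))"
    by (simp add: prod_smult total_spin_def sum_distrib_left exp_sum flip: wick_smult)
  finally show ?thesis .
qed

text \<open>
  After Wick's formula has removed the interaction between the half-edges, the weight of a spin
  configuration is a product over the vertices, and the sum over the spins factorizes.
\<close>

lemma sum_boltzmann_eq_wick: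
  assumes "\<beta> > 0" and deg: "\<And>i. i \<in> {1..N} \<Longrightarrow> d i = 1 \<or> d i = 2"
    and n2: "card {i\<in>{1..N}. d i = 2} = n2" and n1: "N = n1 + n2"
  shows "(\<Sum>P\<in>pairings (half_edges N d). partition_function N \<beta> B (pairing_edges P)) =
    wick (n1 + 2 * n2) ([:vertex1_u \<beta> B, vertex1_v \<beta> B:] ^ n1 *
      [:lam_plus \<beta> B, 0, lam_minus \<beta> B:] ^ n2)"
proof -
  define S1 where "S1 = {i\<in>{1..N}. d i = 1}"
  define S2 where "S2 = {i\<in>{1..N}. d i = 2}"
  have S: "{1..N} = S1 \<union> S2" "S1 \<inter> S2 = {}" "finite S1" "finite S2"
    using deg by (force simp: S1_def S2_def)+
  have c2: "card S2 = n2" by (simp add: S2_def flip: n2)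
  hence c1: "card S1 = n1"
    using card_Un_disjoint[OF S(3,4,2)] n1 by (simp flip: S(1))
  have cH: "card (half_edges N d) = n1 + 2 * n2"
    unfolding card_half_edges S(1) by (subst sum.union_disjoint) (use S c1 c2 in \<open>auto simp: S1_def S2_def\<close>)
  define f where "f = (\<lambda>i \<sigma>. smult (exp (B * \<sigma>)) ([:eig_u \<beta> B \<sigma>, eig_v \<beta> B \<sigma>:] ^ d i))"
  have "(\<Sum>P\<in>pairings (half_edges N d). partition_function N \<beta> B (pairing_edges P)) =
      (\<Sum>\<sigma>\<in>spin_configs N. wick (n1 + 2 * n2) (\<Prod>i\<in>{1..N}. f i (\<sigma> i)))"
    unfolding partition_function_def
    by (subst sum.swap, rule sum.cong)
       (simp_all add: sum_boltzmann_over_pairings[OF assms(1)] cH f_def)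
  also have "\<dots> = wick (n1 + 2 * n2) (\<Prod>i\<in>{1..N}. \<Sum>\<sigma>\<in>{-1, 1}. f i \<sigma>)"
    unfolding wick_sum[symmetric] spin_configs_def by (subst prod_sum_PiE) auto
  also have "(\<Prod>i\<in>{1..N}. \<Sum>\<sigma>\<in>{-1, 1}. f i \<sigma>) =
      (\<Prod>i\<in>S1. \<Sum>\<sigma>\<in>{-1, 1}. f i \<sigma>) * (\<Prod>i\<in>S2. \<Sum>\<sigma>\<in>{-1, 1}. f i \<sigma>)"
    unfolding S(1) by (rule prod.union_disjoint[OF S(3,4,2)])
  also have "(\<Prod>i\<in>S1. \<Sum>\<sigma>\<in>{-1, 1}. f i \<sigma>) = (\<Prod>i\<in>S1. [:vertex1_u \<beta> B, vertex1_v \<beta> B:])"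
    by (rule prod.cong[OF refl], unfold vertex_factor_1[symmetric]) (simp add: f_def S1_def)
  also have "(\<Prod>i\<in>S2. \<Sum>\<sigma>\<in>{-1, 1}. f i \<sigma>) = (\<Prod>i\<in>S2. [:lam_plus \<beta> B, 0, lam_minus \<beta> B:])"
    by (rule prod.cong[OF refl], unfold vertex_factor_2[OF assms(1), symmetric]) (simp add: f_def S2_def)
  finally show ?thesis by (simp add: c1 c2)
qed

lemma linear_poly_power:
  fixes a b :: real
  shows "[:a, b:] ^ n = (\<Sum>k\<le>n. monom (real (n choose k) * b ^ k * a ^ (n - k)) k)"
proof -
  have "[:a, b:] = monom b 1 + monom a 0" by (simp add: monom_altdef)
  thus ?thesis
    by (simp only: binomial_ring) (simp add: monom_power mult_monom of_nat_monom smult_monom algebra_simps)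
qed

lemma even_quadratic_poly_power:
  fixes a b :: real
  shows "[:a, 0, b:] ^ n = (\<Sum>k\<le>n. monom (real (n choose k) * b ^ k * a ^ (n - k)) (2 * k))"
proof -
  have "[:a, 0, b:] = monom b 2 + monom a 0" by (simp add: monom_altdef numeral_2_eq_2)
  thus ?thesis
    by (simp only: binomial_ring) (simp add: monom_power mult_monom of_nat_monom smult_monom algebra_simps)
qed

text \<open>
  Odd Gaussian moments vanish, so that only even exponents survive in the expansions below.
\<close>

lemma sum_atMost_even:
  fixes f :: "nat \<Rightarrow> real"
  assumes "\<And>k. odd k \<Longrightarrow> f k = 0"
  shows "(\<Sum>k\<le>2 * K. f k) = (\<Sum>k\<le>K. f (2 * k))"
  by (induction K) (simp_all add: assms)

text \<open>
  The weight of the choice of \<open>2 k\<close> of the \<open>2 K\<close> linear factors and \<open>l\<close> of the \<open>n\<close> quadratic factors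
  that contribute the variable \<open>Y\<close>.
\<close>

definition gauss_weight :: "nat \<Rightarrow> nat \<Rightarrow> nat \<Rightarrow> nat \<Rightarrow> real" where
  "gauss_weight K n k l = real (2 * K choose (2 * k)) * real (n choose l) *
     gauss_moment (2 * (k + l)) * gauss_moment (2 * (K + n - (k + l))) / gauss_moment (2 * (K + n))"

definition gauss_sum :: "nat \<Rightarrow> nat \<Rightarrow> real \<Rightarrow> real \<Rightarrow> real" where
  "gauss_sum K n c r = (\<Sum>k\<le>K. \<Sum>l\<le>n. gauss_weight K n k l * c ^ k * r ^ l)"

lemma wick_product_expand:
  fixes a b a' b' :: real
  assumes "a \<noteq> 0" "a' \<noteq> 0"
  shows "wick (2 * K + 2 * n) ([:a, b:] ^ (2 * K) * [:a', 0, b':] ^ n) =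
    gauss_moment (2 * (K + n)) * a ^ (2 * K) * a' ^ n * gauss_sum K n (b\<^sup>2 / a\<^sup>2) (b' / a')"
proof -
  have gm: "gauss_moment (2 * (K + n)) \<noteq> 0" by (subst gauss_moment_even) simp
  define f where "f = (\<lambda>k. \<Sum>l\<le>n. real (2 * K choose k) * b ^ k * a ^ (2 * K - k) *
    (real (n choose l) * b' ^ l * a' ^ (n - l)) *
    gauss_moment (k + 2 * l) * gauss_moment (2 * K + 2 * n - (k + 2 * l)))"
  have "wick (2 * K + 2 * n) ([:a, b:] ^ (2 * K) * [:a', 0, b':] ^ n) = (\<Sum>k\<le>2 * K. f k)"
    unfolding linear_poly_power even_quadratic_poly_power sum_product wick_sum mult_monom f_def
    by (intro sum.cong refl wick_monom) auto
  also have "\<dots> = (\<Sum>k\<le>K. f (2 * k))"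
    by (rule sum_atMost_even) (simp add: f_def gauss_moment_odd)
  also have "\<dots> = (\<Sum>k\<le>K. \<Sum>l\<le>n. gauss_moment (2 * (K + n)) * a ^ (2 * K) * a' ^ n *
      (gauss_weight K n k l * (b\<^sup>2 / a\<^sup>2) ^ k * (b' / a') ^ l))"
    unfolding f_def
  proof (intro sum.cong refl)
    fix k l assume "k \<in> {..K}" "l \<in> {..n}"
    hence kl: "k \<le> K" "l \<le> n" by auto
    have 1: "a ^ (2 * K) * (b\<^sup>2 / a\<^sup>2) ^ k = b ^ (2 * k) * a ^ (2 * K - 2 * k)"
      using assms kl by (simp add: power_divide power_diff flip: power_mult)
    have 2: "a' ^ n * (b' / a') ^ l = b' ^ l * a' ^ (n - l)"
      using assms kl by (simp add: power_divide power_diff)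
    have "gauss_moment (2 * (K + n)) * a ^ (2 * K) * a' ^ n *
      (gauss_weight K n k l * (b\<^sup>2 / a\<^sup>2) ^ k * (b' / a') ^ l) =
      (gauss_moment (2 * (K + n)) * gauss_weight K n k l) * (a ^ (2 * K) * (b\<^sup>2 / a\<^sup>2) ^ k) * (a' ^ n * (b' / a') ^ l)"
      by (simp only: ac_simps)
    also have "\<dots> = real (2 * K choose (2 * k)) * b ^ (2 * k) * a ^ (2 * K - 2 * k) *
         (real (n choose l) * b' ^ l * a' ^ (n - l)) *
         gauss_moment (2 * k + 2 * l) * gauss_moment (2 * K + 2 * n - (2 * k + 2 * l))"
      unfolding 1 2 using gm by (simp add: gauss_weight_def algebra_simps diff_mult_distrib2)
    finally show "real (2 * K choose (2 * k)) * b ^ (2 * k) * a ^ (2 * K - 2 * k) *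
         (real (n choose l) * b' ^ l * a' ^ (n - l)) *
         gauss_moment (2 * k + 2 * l) * gauss_moment (2 * K + 2 * n - (2 * k + 2 * l)) =
      gauss_moment (2 * (K + n)) * a ^ (2 * K) * a' ^ n *
      (gauss_weight K n k l * (b\<^sup>2 / a\<^sup>2) ^ k * (b' / a') ^ l)" ..
  qed
  finally show ?thesis
    by (simp add: gauss_sum_def sum_distrib_left)
qed

theorem annealed_partition_function_eq:
  assumes "\<beta> > 0" and deg: "\<And>i. i \<in> {1..N} \<Longrightarrow> d i = 1 \<or> d i = 2"
    and n2: "card {i\<in>{1..N}. d i = 2} = n" and N: "N = 2 * K + n"
  shows "annealed_partition_function N d \<beta> B =
    lam_plus \<beta> B ^ N * A_plus \<beta> B ^ K * gauss_sum K n (a_ratio \<beta> B * (r_ratio \<beta> B)\<^sup>2) (r_ratio \<beta> B)"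
    and "pairings (half_edges N d) \<noteq> {}"
proof -
  have Z: "(\<Sum>P\<in>pairings (half_edges N d). partition_function N \<beta> B (pairing_edges P)) =
    wick (2 * K + 2 * n) ([:vertex1_u \<beta> B, vertex1_v \<beta> B:] ^ (2 * K) *
      [:lam_plus \<beta> B, 0, lam_minus \<beta> B:] ^ n)"
    by (rule sum_boltzmann_eq_wick[OF assms(1) deg n2 N])
  have "card (half_edges N d) = 2 * (K + n)"
  proof -
    have "(\<Sum>i\<in>{1..N}. d i) = (\<Sum>i\<in>{1..N}. 1 + (if d i = 2 then 1 else 0))"
      by (rule sum.cong) (use deg in auto)
    also have "\<dots> = N + n"
      unfolding sum.distrib by (subst sum.inter_filter[symmetric]) (simp_all flip: n2)
    finally show ?thesis using N by (simp add: card_half_edges)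
  qed
  hence card: "real (card (pairings (half_edges N d))) = gauss_moment (2 * (K + n))"
    by (simp add: card_pairings[OF finite_half_edges])
  have gm: "gauss_moment (2 * (K + n)) \<noteq> 0" by (subst gauss_moment_even) simp
  show ne: "pairings (half_edges N d) \<noteq> {}" using card gm by auto
  have fin: "finite (pairings (half_edges N d))" by (rule finite_pairings[OF finite_half_edges])
  have u: "(vertex1_u \<beta> B)\<^sup>2 = A_plus \<beta> B * (lam_plus \<beta> B)\<^sup>2"
    and v: "(vertex1_v \<beta> B)\<^sup>2 = A_minus \<beta> B * (lam_minus \<beta> B)\<^sup>2"
    using vertex1_squares[OF assms(1)] by auto
  have lp: "lam_plus \<beta> B > 0" by (rule lam_plus_pos)
  have u0: "vertex1_u \<beta> B \<noteq> 0"
  proof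
    assume "vertex1_u \<beta> B = 0"
    thus False using u lp A_plus_pos[of \<beta> B] by simp
  qed
  have ratio: "(vertex1_v \<beta> B)\<^sup>2 / (vertex1_u \<beta> B)\<^sup>2 = a_ratio \<beta> B * (r_ratio \<beta> B)\<^sup>2"
    unfolding u v a_ratio_def r_ratio_def by (simp add: power_divide)
  have up: "vertex1_u \<beta> B ^ (2 * K) * lam_plus \<beta> B ^ n = lam_plus \<beta> B ^ N * A_plus \<beta> B ^ K"
    unfolding power_mult u N power_add by (simp add: power_mult_distrib flip: power_mult)
  have "annealed_partition_function N d \<beta> B =
      (\<Sum>P\<in>pairings (half_edges N d). partition_function N \<beta> B (pairing_edges P)) /
      gauss_moment (2 * (K + n))"
    unfolding annealed_partition_function_def configuration_model_def
    by (simp add: integral_pmf_of_set[OF ne fin] card)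
  also have "\<dots> = vertex1_u \<beta> B ^ (2 * K) * lam_plus \<beta> B ^ n *
      gauss_sum K n (a_ratio \<beta> B * (r_ratio \<beta> B)\<^sup>2) (r_ratio \<beta> B)"
    unfolding Z wick_product_expand[OF u0 less_imp_neq[OF lp, symmetric]] ratio
      r_ratio_def[symmetric] using gm by simp
  finally show "annealed_partition_function N d \<beta> B =
    lam_plus \<beta> B ^ N * A_plus \<beta> B ^ K * gauss_sum K n (a_ratio \<beta> B * (r_ratio \<beta> B)\<^sup>2) (r_ratio \<beta> B)"
    unfolding up .
qed

section \<open>Entropy estimates\<close>

definition xlnx :: "real \<Rightarrow> real" where "xlnx x = x * ln x"

text \<open>
  The exponential growth rate of the binomial coefficient of \<open>(s + t) N\<close> over \<open>s N\<close>.
\<close>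

definition mix_entropy :: "real \<Rightarrow> real \<Rightarrow> real" where
  "mix_entropy s t = xlnx (s + t) - xlnx s - xlnx t"

text \<open>
  The components of the multigraph that are not cycles are \<open>\<nu> N\<close> paths between vertices of degree 1,
  along which \<open>\<pi> N\<close> vertices of degree 2 are distributed. The entropy is the growth rate of the expected
  number of ways to choose \<open>s N\<close> of the paths such that they contain \<open>t N\<close> vertices of degree 2: the
  third summand stands for the choice of the paths, the first two summands for the distributions of
  the vertices inside and outside the chosen paths, and the last summand for all distributions. In this
  form scaling and concavity are inherited from \<open>mix_entropy\<close>.
\<close>

definition path_entropy :: "real \<Rightarrow> real \<Rightarrow> real \<Rightarrow> real \<Rightarrow> real" where
  "path_entropy \<nu> \<pi> s t =
     mix_entropy s t + mix_entropy (\<nu> - s) (\<pi> - t) + mix_entropy s (\<nu> - s) - mix_entropy \<nu> \<pi>"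

lemma mix_entropy_0 [simp]: "mix_entropy 0 t = 0" "mix_entropy s 0 = 0"
  by (simp_all add: mix_entropy_def xlnx_def)

lemma xlnx_mult: "x \<ge> 0 \<Longrightarrow> N > 0 \<Longrightarrow> xlnx (N * x) = N * xlnx x + N * ln N * x"
  by (cases "x = 0") (simp_all add: xlnx_def ln_mult algebra_simps)

lemma mix_entropy_scale:
  "s \<ge> 0 \<Longrightarrow> t \<ge> 0 \<Longrightarrow> N > 0 \<Longrightarrow> mix_entropy (N * s) (N * t) = N * mix_entropy s t"
  using xlnx_mult[of s N] xlnx_mult[of t N] xlnx_mult[of "s + t" N]
  unfolding mix_entropy_def by (simp add: algebra_simps)

lemma path_entropy_scale:
  assumes "0 \<le> s" "s \<le> \<nu>" "0 \<le> t" "t \<le> \<pi>" "N > 0"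
  shows "path_entropy (N * \<nu>) (N * \<pi>) (N * s) (N * t) = N * path_entropy \<nu> \<pi> s t"
proof -
  have "0 \<le> \<nu> - s" "0 \<le> \<pi> - t" "0 \<le> \<nu>" "0 \<le> \<pi>" using assms by auto
  with assms show ?thesis
    unfolding path_entropy_def right_diff_distrib[symmetric]
    by (simp only: mix_entropy_scale) (simp add: algebra_simps)
qed

lemma xlnx_gibbs:
  assumes "s \<ge> 0" "y > 0"
  shows "s * ln y - xlnx s \<le> y - s" "s \<noteq> y \<Longrightarrow> s * ln y - xlnx s < y - s"
proof -
  have "s * ln y - xlnx s \<le> y - s \<and> (s \<noteq> y \<longrightarrow> s * ln y - xlnx s < y - s)"
  proof (cases "s = 0")
    case True thus ?thesis using assms by (simp add: xlnx_def)
  next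
    case False
    hence s: "s > 0" using assms by simp
    have eq: "s * ln y - xlnx s = s * ln (y / s)" "y - s = s * (y / s - 1)"
      using s assms by (simp_all add: xlnx_def ln_div algebra_simps)
    have "ln (y / s) \<le> y / s - 1" using s assms by (intro ln_le_minus_one) auto
    moreover have "ln (y / s) \<noteq> y / s - 1" if "s \<noteq> y"
      using that s assms ln_eq_minus_one[of "y / s"] by (auto simp: field_simps)
    ultimately show ?thesis unfolding eq using s by (auto simp: less_le)
  qed
  thus "s * ln y - xlnx s \<le> y - s" "s \<noteq> y \<Longrightarrow> s * ln y - xlnx s < y - s" by auto
qed

text \<open>
  Gibbs' inequality: the entropy of a distribution is at most its cross entropy relative to any other
  distribution \<open>(x, y)\<close>, with equality only if the two are proportional.
\<close>

lemma mix_entropy_le: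
  assumes "s \<ge> 0" "t \<ge> 0" "x > 0" "y > 0" "x + y = 1"
  shows "mix_entropy s t \<le> - s * ln x - t * ln y"
    and "s * y \<noteq> t * x \<Longrightarrow> mix_entropy s t < - s * ln x - t * ln y"
proof -
  have "mix_entropy s t \<le> - s * ln x - t * ln y \<and>
    (s * y \<noteq> t * x \<longrightarrow> mix_entropy s t < - s * ln x - t * ln y)"
  proof (cases "s + t = 0")
    case True
    hence "s = 0" "t = 0" using assms by auto
    thus ?thesis by (simp add: mix_entropy_def xlnx_def)
  next
    case False
    hence st: "s + t > 0" using assms by simp
    have l: "ln (x * (s + t)) = ln x + ln (s + t)" "ln (y * (s + t)) = ln y + ln (s + t)"
      using st assms by (simp_all add: ln_mult)
    have p: "x * (s + t) > 0" "y * (s + t) > 0" using st assms by auto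
    have xy: "x * (s + t) + y * (s + t) = s + t"
      using assms(5) by (simp flip: distrib_right)
    have ne: "s \<noteq> x * (s + t)" if "s * y \<noteq> t * x"
    proof
      assume "s = x * (s + t)"
      hence "s * y = t * x" using assms(5) by algebra
      thus False using that by simp
    qed
    have "mix_entropy s t + s * ln x + t * ln y =
        (s * ln (x * (s + t)) - xlnx s) + (t * ln (y * (s + t)) - xlnx t)"
      unfolding mix_entropy_def l xlnx_def[of "s + t"] by (simp add: algebra_simps)
    hence E: "mix_entropy s t = - s * ln x - t * ln y
        + (s * ln (x * (s + t)) - xlnx s) + (t * ln (y * (s + t)) - xlnx t)" by simp
    note g = xlnx_gibbs[OF assms(1) p(1)] xlnx_gibbs(1)[OF assms(2) p(2)]
    have "mix_entropy s t \<le> - s * ln x - t * ln y"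
      unfolding E using g(1,3) xy by linarith
    moreover have "mix_entropy s t < - s * ln x - t * ln y" if "s * y \<noteq> t * x"
      unfolding E using g(2)[OF ne[OF that]] g(3) xy by linarith
    ultimately show ?thesis by blast
  qed
  thus "mix_entropy s t \<le> - s * ln x - t * ln y"
    "s * y \<noteq> t * x \<Longrightarrow> mix_entropy s t < - s * ln x - t * ln y" by auto
qed

lemma mix_entropy_eq:
  assumes "s > 0" "t > 0"
  shows "mix_entropy s t = - s * ln (s / (s + t)) - t * ln (t / (s + t))"
  using assms by (simp add: mix_entropy_def xlnx_def ln_div algebra_simps)

text \<open>
  Apply Gibbs' inequality to both summands with the distribution proportional to \<open>(s + s', t + t')\<close>;
  the cross entropies add up to the right-hand side. Together with homogeneity this is concavity, which
  is strict except along rays through the origin.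
\<close>

lemma mix_entropy_superadditive:
  assumes "s \<ge> 0" "t \<ge> 0" "s' \<ge> 0" "t' \<ge> 0"
  shows "mix_entropy s t + mix_entropy s' t' \<le> mix_entropy (s + s') (t + t')"
    and "s * t' \<noteq> s' * t \<Longrightarrow> mix_entropy s t + mix_entropy s' t' < mix_entropy (s + s') (t + t')"
proof -
  define S T where "S = s + s'" and "T = t + t'"
  have "mix_entropy s t + mix_entropy s' t' \<le> mix_entropy S T \<and>
    (s * t' \<noteq> s' * t \<longrightarrow> mix_entropy s t + mix_entropy s' t' < mix_entropy S T)"
  proof (cases "S = 0 \<or> T = 0")
    case True
    hence "(s = 0 \<and> s' = 0) \<or> (t = 0 \<and> t' = 0)" using assms by (auto simp: S_def T_def)
    thus ?thesis by (auto simp: S_def T_def)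
  next
    case False
    hence ST: "S > 0" "T > 0" using assms by (auto simp: S_def T_def)
    define x y where "x = S / (S + T)" and "y = T / (S + T)"
    have xy: "x > 0" "y > 0" "x + y = 1"
      using ST by (simp_all add: x_def y_def flip: add_divide_distrib)
    have E: "mix_entropy S T = (- s * ln x - t * ln y) + (- s' * ln x - t' * ln y)"
      unfolding mix_entropy_eq[OF ST] x_def[symmetric] y_def[symmetric]
      by (simp add: S_def T_def algebra_simps)
    have "s * y \<noteq> t * x" if "s * t' \<noteq> s' * t"
      using that ST by (simp add: x_def y_def field_simps) (simp add: S_def T_def algebra_simps)
    thus ?thesis unfolding E
      using mix_entropy_le[OF assms(1,2) xy] mix_entropy_le(1)[OF assms(3,4) xy] by auto
  qed
  thus "mix_entropy s t + mix_entropy s' t' \<le> mix_entropy (s + s') (t + t')"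
    "s * t' \<noteq> s' * t \<Longrightarrow> mix_entropy s t + mix_entropy s' t' < mix_entropy (s + s') (t + t')"
    by (auto simp: S_def T_def)
qed

text \<open>
  The three mixing entropies that depend on the point are concave by superadditivity. Equality for the
  third one forces \<open>s = s'\<close>, and then equality for the first two forces \<open>t = t'\<close>.
\<close>

lemma path_entropy_strictly_midpoint_concave:
  assumes "\<nu> > 0" "0 \<le> s" "s \<le> \<nu>" "0 \<le> t" "t \<le> \<pi>" "0 \<le> s'" "s' \<le> \<nu>" "0 \<le> t'" "t' \<le> \<pi>"
    and "(s, t) \<noteq> (s', t')"
  shows "path_entropy \<nu> \<pi> s t + path_entropy \<nu> \<pi> s' t' < 2 * path_entropy \<nu> \<pi> ((s + s') / 2) ((t + t') / 2)"
proof -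
  have half: "2 * mix_entropy (a / 2) (b / 2) = mix_entropy a b" if "a \<ge> 0" "b \<ge> 0" for a b
    using mix_entropy_scale[OF that, of "1 / 2"] by simp
  have h1: "2 * mix_entropy ((s + s') / 2) ((t + t') / 2) = mix_entropy (s + s') (t + t')"
    using assms by (intro half) auto
  have h2: "2 * mix_entropy (\<nu> - (s + s') / 2) (\<pi> - (t + t') / 2) =
      mix_entropy ((\<nu> - s) + (\<nu> - s')) ((\<pi> - t) + (\<pi> - t'))"
    using assms half[of "(\<nu> - s) + (\<nu> - s')" "(\<pi> - t) + (\<pi> - t')"] by (simp add: field_simps)
  have h3: "2 * mix_entropy ((s + s') / 2) (\<nu> - (s + s') / 2) =
      mix_entropy (s + s') ((\<nu> - s) + (\<nu> - s'))"
    using assms half[of "s + s'" "(\<nu> - s) + (\<nu> - s')"] by (simp add: field_simps)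
  have pos: "0 \<le> \<nu> - s" "0 \<le> \<nu> - s'" "0 \<le> \<pi> - t" "0 \<le> \<pi> - t'" using assms by auto
  note a = mix_entropy_superadditive[OF assms(2,4,6,8)]
  note b = mix_entropy_superadditive[OF pos(1,3,2,4)]
  note c = mix_entropy_superadditive[OF assms(2) pos(1) assms(6) pos(2)]
  have "s * t' \<noteq> s' * t \<or> (\<nu> - s) * (\<pi> - t') \<noteq> (\<nu> - s') * (\<pi> - t) \<or> s * (\<nu> - s') \<noteq> s' * (\<nu> - s)"
  proof (rule ccontr)
    assume "\<not> ?thesis"
    hence eq: "s * t' = s' * t" "(\<nu> - s) * (\<pi> - t') = (\<nu> - s') * (\<pi> - t)" "s * (\<nu> - s') = s' * (\<nu> - s)"
      by auto
    have "\<nu> * (s - s') = 0" using eq(3) by (simp add: algebra_simps)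
    hence ss: "s = s'" using assms(1) by simp
    have "\<nu> * (t - t') = 0" using eq(1,2) unfolding ss by algebra
    hence "t = t'" using assms(1) by simp
    thus False using ss assms(10) by simp
  qed
  hence "mix_entropy s t + mix_entropy s' t' + (mix_entropy (\<nu> - s) (\<pi> - t)
      + mix_entropy (\<nu> - s') (\<pi> - t')) + (mix_entropy s (\<nu> - s) + mix_entropy s' (\<nu> - s'))
    < mix_entropy (s + s') (t + t') + mix_entropy ((\<nu> - s) + (\<nu> - s')) ((\<pi> - t) + (\<pi> - t'))
      + mix_entropy (s + s') ((\<nu> - s) + (\<nu> - s'))"
  proof (elim disjE)
    assume "s * t' \<noteq> s' * t"
    from a(2)[OF this] b(1) c(1) show ?thesis by linarith
  next
    assume "(\<nu> - s) * (\<pi> - t') \<noteq> (\<nu> - s') * (\<pi> - t)"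
    from a(1) b(2)[OF this] c(1) show ?thesis by linarith
  next
    assume "s * (\<nu> - s') \<noteq> s' * (\<nu> - s)"
    from a(1) b(1) c(2)[OF this] show ?thesis by linarith
  qed
  thus ?thesis
    unfolding path_entropy_def right_diff_distrib distrib_left h1 h2 h3 by linarith
qed

text \<open>
  Every mixing entropy is bounded by a cross entropy, which is linear in \<open>(s, t)\<close>. The reference
  distributions are chosen such that all terms with \<open>t\<close> and then all terms with \<open>s\<close> cancel. The bound
  tends to \<open>0\<close> linearly as \<open>c\<close> tends to \<open>0\<close>, which is what controls the limit of vanishing field.
\<close>

lemma path_entropy_tilted_le:
  assumes "\<nu> > 0" "\<pi> > 0" "0 < r" "r < 1" "c > 0" "0 \<le> s" "s \<le> \<nu>" "0 \<le> t" "t \<le> \<pi>"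
  shows "path_entropy \<nu> \<pi> s t + s * ln c + t * ln r \<le> \<nu> * ln (1 + c * \<nu> / (\<nu> + \<pi> - r * \<pi>))"
proof -
  define q where "q = \<nu> + \<pi>"
  have "r * \<pi> < \<pi>"
    using mult_strict_right_mono[OF assms(4,2)] by (simp only: mult_1)
  hence q: "q > 0" "r * \<pi> < q" using assms(1,2) unfolding q_def by linarith+
  \<comment> \<open>this value of \<open>y\<close> cancels the coefficient of \<open>t\<close>\<close>
  define y where "y = r * \<pi> / q"
  define x where "x = 1 - y"
  have xy: "x > 0" "y > 0" "x + y = 1" using assms q by (auto simp: x_def y_def)
  \<comment> \<open>and this value collects the remaining coefficients of \<open>s\<close>\<close>
  define \<kappa> where "\<kappa> = \<nu> / (q * x)"
  have \<kappa>: "\<kappa> > 0" using assms q xy by (simp add: \<kappa>_def)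
  have c\<kappa>: "c * \<kappa> > 0" using assms \<kappa> by simp
  have 1: "mix_entropy s t \<le> - s * ln x - t * ln y"
    using assms xy by (intro mix_entropy_le) auto
  have 2: "mix_entropy (\<nu> - s) (\<pi> - t) \<le> - (\<nu> - s) * ln (\<nu> / q) - (\<pi> - t) * ln (\<pi> / q)"
    using assms q by (intro mix_entropy_le) (auto simp: q_def simp flip: add_divide_distrib)
  have 3: "mix_entropy s (\<nu> - s) \<le> - s * ln (c * \<kappa> / (1 + c * \<kappa>)) - (\<nu> - s) * ln (1 / (1 + c * \<kappa>))"
    using assms c\<kappa> by (intro mix_entropy_le) (auto simp flip: add_divide_distrib)
  have 4: "mix_entropy \<nu> \<pi> = - \<nu> * ln (\<nu> / q) - \<pi> * ln (\<pi> / q)"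
    unfolding q_def using assms by (intro mix_entropy_eq)
  have ly: "ln y = ln r + ln (\<pi> / q)" using assms q by (simp add: y_def ln_mult ln_div)
  have l\<kappa>: "ln \<kappa> = ln (\<nu> / q) - ln x" using assms q xy by (simp add: \<kappa>_def ln_mult ln_div)
  have lc: "ln (c * \<kappa> / (1 + c * \<kappa>)) = ln c + ln \<kappa> - ln (1 + c * \<kappa>)"
    using assms \<kappa> c\<kappa> add_pos_pos[OF zero_less_one c\<kappa>] by (simp add: ln_mult ln_div)
  have l1: "ln (1 / (1 + c * \<kappa>)) = - ln (1 + c * \<kappa>)" using c\<kappa> by (simp add: ln_div)
  have "path_entropy \<nu> \<pi> s t + s * ln c + t * ln r \<le> \<nu> * ln (1 + c * \<kappa>)"
    unfolding path_entropy_def using 1 2 3 4 unfolding ly lc l1 l\<kappa> by (simp add: algebra_simps)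
  also have "c * \<kappa> = c * \<nu> / (\<nu> + \<pi> - r * \<pi>)"
  proof -
    have "q * x = q - r * \<pi>" using q by (simp add: x_def y_def right_diff_distrib)
    thus ?thesis by (simp add: \<kappa>_def q_def)
  qed
  finally show ?thesis .
qed

lemma path_entropy_0_less:
  assumes "\<nu> > 0" "0 < r" "r < 1" "0 < t" "t \<le> \<pi>"
  shows "path_entropy \<nu> \<pi> 0 t + t * ln r < 0"
proof -
  have p: "\<pi> > 0" using assms by simp
  have 2: "mix_entropy \<nu> (\<pi> - t) \<le> - \<nu> * ln (\<nu> / (\<nu> + \<pi>)) - (\<pi> - t) * ln (\<pi> / (\<nu> + \<pi>))"
    using assms p by (intro mix_entropy_le) (auto simp flip: add_divide_distrib)
  have "t * ln (\<pi> / (\<nu> + \<pi>)) < 0" "t * ln r < 0"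
    using assms by (auto intro!: mult_pos_neg)
  thus ?thesis
    unfolding path_entropy_def mix_entropy_eq[OF assms(1) p] using 2 by (simp add: algebra_simps)
qed

lemma path_entropy_0_0 [simp]: "path_entropy \<nu> \<pi> 0 0 = 0"
  by (simp add: path_entropy_def)

lemma continuous_on_xlnx [continuous_intros]:
  fixes f :: "'a::topological_space \<Rightarrow> real"
  assumes "continuous_on S f" "\<And>x. x \<in> S \<Longrightarrow> f x \<ge> 0"
  shows "continuous_on S (\<lambda>x. xlnx (f x))"
  unfolding xlnx_def using assms by (rule continuous_on_mult_ln_self)

lemma continuous_on_mix_entropy [continuous_intros]:
  fixes f g :: "'a::topological_space \<Rightarrow> real"
  assumes "continuous_on S f" "\<And>x. x \<in> S \<Longrightarrow> f x \<ge> 0"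
    "continuous_on S g" "\<And>x. x \<in> S \<Longrightarrow> g x \<ge> 0"
  shows "continuous_on S (\<lambda>x. mix_entropy (f x) (g x))"
  unfolding mix_entropy_def using assms by (intro continuous_intros) (auto intro: add_nonneg_nonneg)

lemma continuous_on_path_entropy [continuous_intros]:
  fixes \<nu> \<pi> s t :: "'a::topological_space \<Rightarrow> real"
  assumes "continuous_on S \<nu>" "continuous_on S \<pi>" "continuous_on S s" "continuous_on S t"
    and "\<And>x. x \<in> S \<Longrightarrow> 0 \<le> s x \<and> s x \<le> \<nu> x" "\<And>x. x \<in> S \<Longrightarrow> 0 \<le> t x \<and> t x \<le> \<pi> x"
  shows "continuous_on S (\<lambda>x. path_entropy (\<nu> x) (\<pi> x) (s x) (t x))"
proof -
  have "0 \<le> \<nu> x" "0 \<le> \<pi> x" if "x \<in> S" for x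
    using assms(5,6)[OF that] by linarith+
  thus ?thesis
    unfolding path_entropy_def using assms by (intro continuous_intros) auto
qed

section \<open>Exponential growth of the Gaussian sum\<close>

text \<open>
  Stirling's formula up to a logarithmic error. The generous factor 2 of the error term makes the
  upper bound provable by a plain induction.
\<close>

lemma ln_fact_bounds:
  "xlnx (real j) - real j \<le> ln (fact j)" "ln (fact j) \<le> xlnx (real j) - real j + 2 * ln (real j + 1)"
proof -
  have "xlnx (real j) - real j \<le> ln (fact j) \<and>
    ln (fact j) \<le> xlnx (real j) - real j + 2 * ln (real j + 1)"
  proof (induction j)
    case 0 show ?case by (simp add: xlnx_def)
  next
    case (Suc j)
    have f: "ln (fact (Suc j) :: real) = ln (real j + 1) + ln (fact j)"
      by (simp add: ln_mult add.commute)
    have x: "xlnx (real (Suc j)) = real j * ln (real j + 1) + ln (real j + 1)"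
      by (simp add: xlnx_def algebra_simps)
    have up: "real j * ln (real j + 1) - xlnx (real j) \<le> 1"
      using xlnx_gibbs(1)[of "real j" "real j + 1"] by simp
    have lo: "real j * ln (real j + 1) - xlnx (real j) \<ge> real j / (real j + 1)"
    proof (cases "j = 0")
      case False
      have "ln (real j / (real j + 1)) \<le> real j / (real j + 1) - 1"
        using False by (intro ln_le_minus_one) auto
      hence "ln (real j + 1) - ln (real j) \<ge> 1 / (real j + 1)"
        using False by (simp add: ln_div field_simps)
      hence "real j * (ln (real j + 1) - ln (real j)) \<ge> real j * (1 / (real j + 1))"
        by (intro mult_left_mono) auto
      thus ?thesis by (simp add: xlnx_def algebra_simps)
    qed (simp add: xlnx_def)
    have "ln ((real j + 1) / (real j + 2)) \<le> (real j + 1) / (real j + 2) - 1"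
      by (intro ln_le_minus_one) auto
    hence "ln (real j + 2) - ln (real j + 1) \<ge> 1 / (real j + 2)"
      by (simp add: ln_div field_simps)
    moreover have "real j / (real j + 1) + 2 * (1 / (real j + 2)) \<ge> 1"
      by (simp add: divide_simps) (simp add: algebra_simps)
    ultimately show ?case using Suc lo up unfolding f x by (simp add: algebra_simps)
  qed
  thus "xlnx (real j) - real j \<le> ln (fact j)" "ln (fact j) \<le> xlnx (real j) - real j + 2 * ln (real j + 1)"
    by auto
qed

lemma gauss_weight_pos: "k \<le> K \<Longrightarrow> l \<le> n \<Longrightarrow> gauss_weight K n k l > 0"
  unfolding gauss_weight_def gauss_moment_even
  by (intro divide_pos_pos mult_pos_pos) auto

lemma ln_binomial:
  "k \<le> n \<Longrightarrow> ln (real (n choose k)) = ln (fact n) - ln (fact k) - ln (fact (n - k))"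
  by (subst binomial_fact) (simp_all add: ln_div ln_mult)

lemma ln_gauss_moment:
  "ln (gauss_moment (2 * i)) = ln (fact (2 * i)) - real i * ln 2 - ln (fact i)"
  by (simp add: gauss_moment_even ln_div ln_mult ln_realpow)

text \<open>
  By Stirling's formula for the factorials in the weight. The terms that are linear in the arguments
  of the factorials cancel, and so do the powers of 2 in the Gaussian moments.
\<close>

lemma ln_gauss_weight:
  assumes "k \<le> K" "l \<le> n"
  shows "\<bar>ln (gauss_weight K n k l) - path_entropy (real K) (real n) (real k) (real l)\<bar> \<le>
    14 * ln (2 * (real K + real n) + 1)"
proof -
  define D where "D = 2 * ln (2 * (real K + real n) + 1)"
  have b: "\<exists>\<delta>. ln (fact j) = xlnx (real j) - real j + \<delta> \<and> 0 \<le> \<delta> \<and> \<delta> \<le> D" if "j \<le> 2 * (K + n)" for j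
  proof -
    have "ln (real j + 1) \<le> ln (2 * (real K + real n) + 1)" using that by simp
    thus ?thesis using ln_fact_bounds[of j]
      unfolding D_def
      by (intro exI[of _ "ln (fact j) - (xlnx (real j) - real j)"] conjI) linarith+
  qed
  define a m where "a = k + l" and "m = K + n"
  have am: "a \<le> m" using assms by (simp add: a_def m_def)
  have dbl: "xlnx (real (2 * j)) = 2 * xlnx (real j) + 2 * ln 2 * real j" for j
    using xlnx_mult[of "real j" 2] by simp
  have pos: "gauss_moment (2 * i) > 0" for i by (simp add: gauss_moment_even)
  have L: "ln (gauss_weight K n k l) = ln (real (2 * K choose (2 * k))) + ln (real (n choose l))
     + ln (gauss_moment (2 * a)) + ln (gauss_moment (2 * (m - a))) - ln (gauss_moment (2 * m))"
    unfolding gauss_weight_def a_def[symmetric] m_def[symmetric]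
    using pos[of a] pos[of m] pos[of "m - a"] assms by (simp add: ln_mult ln_div)
  have ma: "2 * (m - a) \<le> 2 * (K + n)" "m - a \<le> 2 * (K + n)" by (simp_all add: m_def)
  have kK': "2 * (K - k) \<le> 2 * (K + n)" and nl: "n - l \<le> 2 * (K + n)" by simp_all
  obtain d1 where d1: "ln (fact (2 * K)) = xlnx (real (2 * K)) - real (2 * K) + d1" "0 \<le> d1" "d1 \<le> D"
    using b[of "2 * K"] by auto
  obtain d2 where d2: "ln (fact (2 * k)) = xlnx (real (2 * k)) - real (2 * k) + d2" "0 \<le> d2" "d2 \<le> D"
    using b[of "2 * k"] assms by auto
  obtain d3 where d3: "ln (fact (2 * (K - k))) = xlnx (real (2 * (K - k))) - real (2 * (K - k)) + d3"
    "0 \<le> d3" "d3 \<le> D" using b[of "2 * (K - k)", OF kK'] by auto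
  obtain d4 where d4: "ln (fact n) = xlnx (real n) - real n + d4" "0 \<le> d4" "d4 \<le> D"
    using b[of n] by auto
  obtain d5 where d5: "ln (fact l) = xlnx (real l) - real l + d5" "0 \<le> d5" "d5 \<le> D"
    using b[of l] assms by auto
  obtain d6 where d6: "ln (fact (n - l)) = xlnx (real (n - l)) - real (n - l) + d6" "0 \<le> d6" "d6 \<le> D"
    using b[of "n - l", OF nl] by auto
  obtain e1 where e1: "ln (fact (2 * a)) = xlnx (real (2 * a)) - real (2 * a) + e1" "0 \<le> e1" "e1 \<le> D"
    using b[of "2 * a"] am by (auto simp: m_def)
  obtain e2 where e2: "ln (fact a) = xlnx (real a) - real a + e2" "0 \<le> e2" "e2 \<le> D"
    using b[of a] am by (auto simp: m_def)
  obtain e3 where e3: "ln (fact (2 * (m - a))) = xlnx (real (2 * (m - a))) - real (2 * (m - a)) + e3"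
    "0 \<le> e3" "e3 \<le> D" using b[of "2 * (m - a)", OF ma(1)] by auto
  obtain e4 where e4: "ln (fact (m - a)) = xlnx (real (m - a)) - real (m - a) + e4" "0 \<le> e4" "e4 \<le> D"
    using b[of "m - a", OF ma(2)] by auto
  obtain e5 where e5: "ln (fact (2 * m)) = xlnx (real (2 * m)) - real (2 * m) + e5" "0 \<le> e5" "e5 \<le> D"
    using b[of "2 * m"] by (auto simp: m_def)
  obtain e6 where e6: "ln (fact m) = xlnx (real m) - real m + e6" "0 \<le> e6" "e6 \<le> D"
    using b[of m] by (auto simp: m_def)
  have kK: "2 * k \<le> 2 * K" using assms by simp
  have kd: "2 * K - 2 * k = 2 * (K - k)" by simp
  have P: "path_entropy (real K) (real n) (real k) (real l) =
      2 * xlnx (real K) - 2 * xlnx (real k) - 2 * xlnx (real (K - k))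
      + xlnx (real n) - xlnx (real l) - xlnx (real (n - l))
      + xlnx (real a) + xlnx (real (m - a)) - xlnx (real m)"
    using assms am unfolding path_entropy_def mix_entropy_def
    by (simp add: of_nat_diff a_def m_def algebra_simps)
  have sub: "real (K - k) = real K - real k" "real (n - l) = real n - real l"
    "real (m - a) = real m - real a" "real m = real K + real n" "real a = real k + real l"
    using assms am by (simp_all add: of_nat_diff m_def a_def)
  \<comment> \<open>the weight has 5 factorials in the numerator and 7 in the denominator, each with an error of
    at most \<open>D\<close>; hence the constant \<open>14 = 7 * 2\<close>\<close>
  have "ln (gauss_weight K n k l) - path_entropy (real K) (real n) (real k) (real l) =
      d1 - d2 - d3 + d4 - d5 - d6 + e1 - e2 + e3 - e4 - e5 + e6"
  proof -
    note f = d1(1) d2(1) d3(1) d4(1) d5(1) d6(1) e1(1) e2(1) e3(1) e4(1) e5(1) e6(1)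
    define X1 X2 X3 X4 X5 X6 X7 X8 X9 where X: "X1 = xlnx (real K)" "X2 = xlnx (real k)" "X3 = xlnx (real (K - k))"
      "X4 = xlnx (real n)" "X5 = xlnx (real l)" "X6 = xlnx (real (n - l))" "X7 = xlnx (real a)"
      "X8 = xlnx (real (m - a))" "X9 = xlnx (real m)"
    have L': "ln (gauss_weight K n k l) =
      (2 * X1 + 2 * ln 2 * real K - 2 * real K + d1) - (2 * X2 + 2 * ln 2 * real k - 2 * real k + d2)
      - (2 * X3 + 2 * ln 2 * (real K - real k) - 2 * (real K - real k) + d3)
      + ((X4 - real n + d4) - (X5 - real l + d5) - (X6 - (real n - real l) + d6))
      + ((2 * X7 + 2 * ln 2 * real a - 2 * real a + e1) - real a * ln 2 - (X7 - real a + e2))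
      + ((2 * X8 + 2 * ln 2 * (real m - real a) - 2 * (real m - real a) + e3)
          - (real m - real a) * ln 2 - (X8 - (real m - real a) + e4))
      - ((2 * X9 + 2 * ln 2 * real m - 2 * real m + e5) - real m * ln 2 - (X9 - real m + e6))"
      unfolding L ln_binomial[OF kK] ln_binomial[OF assms(2)] ln_gauss_moment kd f dbl X[symmetric]
      by (simp only: of_nat_mult of_nat_numeral sub(1-3))
    show ?thesis
      unfolding L' P X[symmetric]
      unfolding sub(4,5) by (simp add: algebra_simps)
  qed
  thus ?thesis
    using d1 d2 d3 d4 d5 d6 e1 e2 e3 e4 e5 e6 unfolding D_def by linarith
qed

text \<open>
  The sum lies between its largest term and the number of its terms times the largest term. The constant
  16 adds to the 14 of the preceding lemma one logarithm for the number of values of each index. The rescaled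
  variables \<open>k / K\<close> and \<open>l / n\<close> range over the unit square for all \<open>K\<close> and \<open>n\<close>, so that the functions for
  different sizes can be compared.
\<close>

lemma gauss_sum_bounds:
  assumes "c > 0" "r > 0" "K > 0" "n > 0" "N > 0"
    and f: "f = (\<lambda>x y. path_entropy (K / N) (n / N) (K / N * x) (n / N * y)
                  + (K / N * x) * ln c + (n / N * y) * ln r)"
    and e: "e = 16 * ln (2 * (real K + real n) + 1)"
  shows "\<And>k l. k \<le> K \<Longrightarrow> l \<le> n \<Longrightarrow> N * f (k / K) (l / n) - e \<le> ln (gauss_sum K n c r)"
    and "(\<And>k l. k \<le> K \<Longrightarrow> l \<le> n \<Longrightarrow> f (k / K) (l / n) \<le> M) \<Longrightarrow> ln (gauss_sum K n c r) \<le> N * M + e"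
proof -
  define L where "L = ln (2 * (real K + real n) + 1)"
  have L: "L \<ge> 0" "e = 16 * L" by (simp_all add: L_def e)
  have bd: "\<bar>ln (gauss_weight K n k l * c ^ k * r ^ l) - N * f (k / K) (l / n)\<bar> \<le> 14 * L"
    if "k \<le> K" "l \<le> n" for k l
  proof -
    have "N * f (k / K) (l / n) = path_entropy K n k l + k * ln c + l * ln r"
      using path_entropy_scale[of "real k / N" "real K / N" "real l / N" "real n / N" N] assms that
      by (simp add: f divide_right_mono algebra_simps)
    moreover have "ln (gauss_weight K n k l * c ^ k * r ^ l) = ln (gauss_weight K n k l) + k * ln c + l * ln r"
      using gauss_weight_pos[OF that] assms by (simp add: ln_mult ln_realpow)
    ultimately show ?thesis using ln_gauss_weight[OF that] by (simp add: L_def)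
  qed
  have pos: "gauss_weight K n k l * c ^ k * r ^ l > 0" if "k \<le> K" "l \<le> n" for k l
    using gauss_weight_pos[OF that] assms by simp
  show "N * f (k / K) (l / n) - e \<le> ln (gauss_sum K n c r)" if kl: "k \<le> K" "l \<le> n" for k l
  proof -
    have "gauss_weight K n k l * c ^ k * r ^ l \<le> (\<Sum>l\<le>n. gauss_weight K n k l * c ^ k * r ^ l)"
      using kl pos by (intro member_le_sum[of l]) (auto simp: less_imp_le)
    also have "\<dots> \<le> gauss_sum K n c r"
      unfolding gauss_sum_def using kl pos
      by (intro member_le_sum[of k "{..K}" "\<lambda>k. \<Sum>l\<le>n. gauss_weight K n k l * c ^ k * r ^ l"])
         (auto simp: less_imp_le intro!: sum_nonneg)
    finally have "ln (gauss_weight K n k l * c ^ k * r ^ l) \<le> ln (gauss_sum K n c r)"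
      using pos[OF kl] by (intro ln_mono) auto
    thus ?thesis using bd[OF kl] L by linarith
  qed
  note lower = this
  assume M: "\<And>k l. k \<le> K \<Longrightarrow> l \<le> n \<Longrightarrow> f (k / K) (l / n) \<le> M"
  have "gauss_sum K n c r \<le> (\<Sum>k\<le>K. \<Sum>l\<le>n. exp (N * M + 14 * L))"
    unfolding gauss_sum_def
  proof (intro sum_mono)
    fix k l assume "k \<in> {..K}" "l \<in> {..n}"
    hence kl: "k \<le> K" "l \<le> n" by auto
    have "N * f (k / K) (l / n) \<le> N * M" using M[OF kl] assms by (intro mult_left_mono) auto
    hence "ln (gauss_weight K n k l * c ^ k * r ^ l) \<le> N * M + 14 * L" using bd[OF kl] by linarith
    thus "gauss_weight K n k l * c ^ k * r ^ l \<le> exp (N * M + 14 * L)"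
      using pos[OF kl] by (metis exp_le_cancel_iff exp_ln)
  qed
  also have "\<dots> = (real K + 1) * (real n + 1) * exp (N * M + 14 * L)" by (simp add: algebra_simps)
  finally have up: "gauss_sum K n c r \<le> (real K + 1) * (real n + 1) * exp (N * M + 14 * L)" .
  have gp: "gauss_sum K n c r > 0"
    unfolding gauss_sum_def using pos by (intro sum_pos) auto
  have "ln (gauss_sum K n c r) \<le> ln ((real K + 1) * (real n + 1) * exp (N * M + 14 * L))"
    using up gp by (intro ln_mono) auto
  also have "\<dots> = ln (real K + 1) + ln (real n + 1) + (N * M + 14 * L)"
    by (simp add: ln_mult)
  also have "\<dots> \<le> L + L + (N * M + 14 * L)"
    unfolding L_def by (intro add_mono ln_mono) auto
  finally show "ln (gauss_sum K n c r) \<le> N * M + e" using L by simp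
qed

lemma ln_affine_over_tendsto_0:
  fixes X Y :: "'a \<Rightarrow> real"
  assumes X: "filterlim X at_top F" and Y: "((\<lambda>i. Y i / X i) \<longlongrightarrow> m) F" and "\<And>i. Y i \<ge> 0"
  shows "((\<lambda>i. 16 * ln (2 * Y i + 1) / X i) \<longlongrightarrow> 0) F"
proof (rule tendsto_sandwich[OF _ _ tendsto_const])
  have g: "((\<lambda>x::real. 16 * ln (2 * (\<bar>m\<bar> + 1) * x + 1) / x) \<longlongrightarrow> 0) at_top"
    by real_asymp
  show "((\<lambda>i. 16 * ln (2 * (\<bar>m\<bar> + 1) * X i + 1) / X i) \<longlongrightarrow> 0) F"
    by (rule filterlim_compose[OF g X])
  have Xp: "\<forall>\<^sub>F i in F. X i > 0"
    using X by (rule filterlim_at_top_dense[THEN iffD1, rule_format])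
  thus "\<forall>\<^sub>F i in F. 0 \<le> 16 * ln (2 * Y i + 1) / X i"
    by eventually_elim (use assms(3) in auto)
  have "\<forall>\<^sub>F i in F. Y i / X i < \<bar>m\<bar> + 1"
    by (rule order_tendstoD(2)[OF Y]) auto
  with Xp show "\<forall>\<^sub>F i in F. 16 * ln (2 * Y i + 1) / X i \<le> 16 * ln (2 * (\<bar>m\<bar> + 1) * X i + 1) / X i"
  proof eventually_elim
    case (elim i)
    hence "Y i \<le> (\<bar>m\<bar> + 1) * X i" by (simp add: pos_divide_less_eq less_imp_le)
    hence "ln (2 * Y i + 1) \<le> ln (2 * (\<bar>m\<bar> + 1) * X i + 1)"
      using assms(3)[of i] by (intro ln_mono) (auto simp: algebra_simps)
    thus ?case using elim by (simp add: divide_right_mono)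
  qed
qed

lemma floor_grid_tendsto:
  fixes K :: "'a \<Rightarrow> nat"
  assumes K: "filterlim (\<lambda>i. real (K i)) at_top F" and x: "0 \<le> x" "x \<le> 1"
  shows "((\<lambda>i. real (nat \<lfloor>x * real (K i)\<rfloor>) / real (K i)) \<longlongrightarrow> x) F"
proof (rule tendsto_sandwich[OF _ _ _ tendsto_const])
  have g: "((\<lambda>z::real. x - 1 / z) \<longlongrightarrow> x) at_top" by real_asymp
  show "((\<lambda>i. x - 1 / real (K i)) \<longlongrightarrow> x) F" by (rule filterlim_compose[OF g K])
  have Kp: "\<forall>\<^sub>F i in F. real (K i) > 0"
    using K by (rule filterlim_at_top_dense[THEN iffD1, rule_format])
  have fl: "real (nat \<lfloor>x * real (K i)\<rfloor>) = of_int \<lfloor>x * real (K i)\<rfloor>" for i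
    using x by simp
  from Kp show "\<forall>\<^sub>F i in F. x - 1 / real (K i) \<le> real (nat \<lfloor>x * real (K i)\<rfloor>) / real (K i)"
  proof eventually_elim
    case (elim i)
    have "x * real (K i) - 1 \<le> of_int \<lfloor>x * real (K i)\<rfloor>" by linarith
    hence "(x * real (K i) - 1) / real (K i) \<le> of_int \<lfloor>x * real (K i)\<rfloor> / real (K i)"
      using elim by (intro divide_right_mono) auto
    thus ?case unfolding fl using elim by (simp add: diff_divide_distrib)
  qed
  from Kp show "\<forall>\<^sub>F i in F. real (nat \<lfloor>x * real (K i)\<rfloor>) / real (K i) \<le> x"
    unfolding fl by eventually_elim (simp add: divide_le_eq)
qed

text \<open>
  The principle of the largest term. In the coordinates \<open>x = s / \<nu>\<close> and \<open>y = t / \<pi>\<close> the domain does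
  not depend on the size. Uniform continuity then bounds all terms of the sum by the limiting maximum,
  and a grid point next to the maximum point yields the lower bound.
\<close>

theorem gauss_sum_exponential_rate:
  fixes F :: "nat filter" and K n :: "nat \<Rightarrow> nat"
  assumes F: "filterlim real at_top F"
    and K: "((\<lambda>N. real (K N) / real N) \<longlongrightarrow> \<nu>) F" and n: "((\<lambda>N. real (n N) / real N) \<longlongrightarrow> \<pi>) F"
    and pos: "\<nu> > 0" "\<pi> > 0" "c > 0" "r > 0"
    and z: "0 \<le> s" "s \<le> \<nu>" "0 \<le> t" "t \<le> \<pi>" "V = path_entropy \<nu> \<pi> s t + s * ln c + t * ln r"
    and max: "\<And>s t. 0 \<le> s \<Longrightarrow> s \<le> \<nu> \<Longrightarrow> 0 \<le> t \<Longrightarrow> t \<le> \<pi> \<Longrightarrow>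
        path_entropy \<nu> \<pi> s t + s * ln c + t * ln r \<le> V"
  shows "((\<lambda>N. ln (gauss_sum (K N) (n N) c r) / real N) \<longlongrightarrow> V) F"
proof -
  define f where "f = (\<lambda>(a, b, x, y). path_entropy a b (a * x) (b * y) + (a * x) * ln c + (b * y) * ln r)"
  define Q where "Q = {0..\<nu> + 1} \<times> {0..\<pi> + 1} \<times> {0..1::real} \<times> {0..1::real}"
  have cont: "continuous_on Q f"
    unfolding f_def case_prod_unfold
    by (intro continuous_intros) (auto simp: Q_def mult_left_le)
  have "compact Q" unfolding Q_def by (intro compact_Times compact_Icc)
  hence unif: "uniformly_continuous_on Q f" using cont by (rule compact_uniformly_continuous[rotated])
  have Np: "\<forall>\<^sub>F N in F. real N > 0"
    using F by (rule filterlim_at_top_dense[THEN iffD1, rule_format])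
  have in_box: "\<forall>\<^sub>F N in F. real (K N) / real N \<le> \<nu> + 1 \<and> real (n N) / real N \<le> \<pi> + 1
      \<and> K N > 0 \<and> n N > 0"
  proof -
    have "\<forall>\<^sub>F N in F. real (K N) / real N < \<nu> + 1" "\<forall>\<^sub>F N in F. real (n N) / real N < \<pi> + 1"
      "\<forall>\<^sub>F N in F. real (K N) / real N > 0" "\<forall>\<^sub>F N in F. real (n N) / real N > 0"
      using pos by (auto intro!: order_tendstoD[OF K] order_tendstoD[OF n])
    thus ?thesis by eventually_elim (auto simp: zero_less_divide_iff)
  qed
  define e where "e = (\<lambda>N. 16 * ln (2 * (real (K N) + real (n N)) + 1))"
  have e0: "((\<lambda>N. e N / real N) \<longlongrightarrow> 0) F"
    unfolding e_def using tendsto_add[OF K n]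
    by (intro ln_affine_over_tendsto_0[OF F]) (auto simp: add_divide_distrib)
  have b: "N * f (K N / N, n N / N, k / K N, l / n N) - e N \<le> ln (gauss_sum (K N) (n N) c r)"
    if "N > 0" "K N > 0" "n N > 0" "k \<le> K N" "l \<le> n N" for N k l :: nat
    using gauss_sum_bounds(1)[OF pos(3,4) that(2,3), of "real N", OF _ refl refl that(4,5)] that(1-3)
    by (simp add: f_def e_def)
  have b': "ln (gauss_sum (K N) (n N) c r) \<le> N * M + e N"
    if "N > 0" "K N > 0" "n N > 0"
      and "\<And>k l. k \<le> K N \<Longrightarrow> l \<le> n N \<Longrightarrow> f (K N / N, n N / N, k / K N, l / n N) \<le> M" for N :: nat and M :: real
    using gauss_sum_bounds(2)[OF pos(3,4) that(2,3), of "real N", OF _ refl refl, of M] that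
    by (simp add: f_def e_def)
  have upper: "\<forall>\<^sub>F N in F. ln (gauss_sum (K N) (n N) c r) / real N < V + \<epsilon>" if \<epsilon>: "\<epsilon> > 0" for \<epsilon>
  proof -
    obtain \<delta> where \<delta>: "\<delta> > 0" and u: "\<And>z w. z \<in> Q \<Longrightarrow> w \<in> Q \<Longrightarrow> dist w z < \<delta> \<Longrightarrow> dist (f w) (f z) < \<epsilon> / 2"
      using unif \<epsilon> unfolding uniformly_continuous_on_def by (meson half_gt_zero)
    have "\<forall>\<^sub>F N in F. dist (real (K N) / real N) \<nu> < \<delta> / 2" "\<forall>\<^sub>F N in F. dist (real (n N) / real N) \<pi> < \<delta> / 2"
      "\<forall>\<^sub>F N in F. e N / real N < \<epsilon> / 2"
      using \<delta> \<epsilon> by (intro tendstoD[OF K] tendstoD[OF n] order_tendstoD(2)[OF e0]; simp)+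
    with Np in_box show ?thesis
    proof eventually_elim
      case (elim N)
      have bound: "f (K N / N, n N / N, k / K N, l / n N) \<le> V + \<epsilon> / 2" if kl: "k \<le> K N" "l \<le> n N" for k l
      proof -
        define x y where "x = real k / real (K N)" and "y = real l / real (n N)"
        have xy: "0 \<le> x" "x \<le> 1" "0 \<le> y" "y \<le> 1" using kl elim by (auto simp: x_def y_def)
        have "dist (K N / N, n N / N, x, y) (\<nu>, \<pi>, x, y) \<le> dist (K N / N) \<nu> + dist (n N / N) \<pi>"
          by (simp add: dist_Pair_Pair) (metis dist_real_def real_sqrt_abs sqrt_sum_squares_le_sum_abs abs_abs)
        hence "dist (K N / N, n N / N, x, y) (\<nu>, \<pi>, x, y) < \<delta>" using elim by linarith
        hence "dist (f (K N / N, n N / N, x, y)) (f (\<nu>, \<pi>, x, y)) < \<epsilon> / 2"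
          using elim xy pos by (intro u) (auto simp: Q_def)
        moreover have "f (\<nu>, \<pi>, x, y) \<le> V"
          unfolding f_def using xy pos by (auto intro!: max simp: mult_left_le)
        ultimately show ?thesis unfolding dist_real_def x_def y_def by linarith
      qed
      have "ln (gauss_sum (K N) (n N) c r) \<le> N * (V + \<epsilon> / 2) + e N"
        by (rule b') (use elim bound in auto)
      hence "ln (gauss_sum (K N) (n N) c r) / N \<le> (N * (V + \<epsilon> / 2) + e N) / N"
        by (intro divide_right_mono) auto
      also have "\<dots> = V + \<epsilon> / 2 + e N / N" using elim by (simp add: add_divide_distrib)
      also have "\<dots> < V + \<epsilon>" using elim by linarith
      finally show ?case .
    qed
  qed
  define x y where "x = s / \<nu>" and "y = t / \<pi>"
  have xy: "0 \<le> x" "x \<le> 1" "0 \<le> y" "y \<le> 1" using z pos by (auto simp: x_def y_def)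
  have top: "filterlim (\<lambda>N. real (h N)) at_top F"
    if "((\<lambda>N. real (h N) / real N) \<longlongrightarrow> m) F" "m > 0" for h :: "nat \<Rightarrow> nat" and m
  proof -
    have "filterlim (\<lambda>N. real (h N) / real N * real N) at_top F"
      by (rule filterlim_tendsto_pos_mult_at_top[OF that F])
    thus ?thesis
      by (rule filterlim_mono_eventually[OF _ order_refl order_refl])
         (use Np in eventually_elim, auto)
  qed
  define k l where "k = (\<lambda>N. nat \<lfloor>x * real (K N)\<rfloor>)" and "l = (\<lambda>N. nat \<lfloor>y * real (n N)\<rfloor>)"
  have kl: "k N \<le> K N" "l N \<le> n N" for N
  proof -
    have "x * real (K N) \<le> real (K N)" "y * real (n N) \<le> real (n N)"
      using xy by (simp_all add: mult_left_le_one_le)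
    thus "k N \<le> K N" "l N \<le> n N" unfolding k_def l_def by linarith+
  qed
  define Z where "Z = (\<lambda>N. (K N / real N, n N / real N, k N / real (K N), l N / real (n N)))"
  have "(Z \<longlongrightarrow> (\<nu>, \<pi>, x, y)) F"
    unfolding Z_def k_def l_def
    by (intro tendsto_Pair K n floor_grid_tendsto top[OF K pos(1)] top[OF n pos(2)] xy)
  moreover have "\<forall>\<^sub>F N in F. Z N \<in> Q"
    using in_box by eventually_elim (use kl in \<open>auto simp: Z_def Q_def\<close>)
  ultimately have "((\<lambda>N. f (Z N)) \<longlongrightarrow> f (\<nu>, \<pi>, x, y)) F"
    using pos xy by (intro continuous_on_tendsto_compose[OF cont]) (auto simp: Q_def)
  moreover have "f (\<nu>, \<pi>, x, y) = V" using pos by (simp add: f_def x_def y_def z(5))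
  ultimately have lo: "((\<lambda>N. f (Z N) - e N / real N) \<longlongrightarrow> V) F"
    using tendsto_diff[OF _ e0] by fastforce
  have lower: "\<forall>\<^sub>F N in F. f (Z N) - e N / real N \<le> ln (gauss_sum (K N) (n N) c r) / real N"
    using Np in_box
  proof eventually_elim
    case (elim N)
    have "(N * f (Z N) - e N) / N \<le> ln (gauss_sum (K N) (n N) c r) / N"
      unfolding Z_def using elim kl by (intro divide_right_mono b) auto
    thus ?case using elim by (simp add: diff_divide_distrib)
  qed
  show ?thesis
  proof (rule order_tendstoI)
    fix a assume "a < V"
    from order_tendstoD(1)[OF lo this] lower
    show "\<forall>\<^sub>F N in F. a < ln (gauss_sum (K N) (n N) c r) / real N" by eventually_elim linarith
  next
    fix a assume "V < a"
    thus "\<forall>\<^sub>F N in F. ln (gauss_sum (K N) (n N) c r) / real N < a" using upper[of "a - V"] by simp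
  qed
qed

section \<open>Convexity in the field\<close>

text \<open>
  Jensen's inequality for the exponential function, obtained from its tangent at the mean \<open>m\<close> of \<open>X\<close>.
\<close>

lemma log_sum_exp_subgradient:
  fixes w X :: "'a \<Rightarrow> real"
  assumes "finite S" "\<And>x. x \<in> S \<Longrightarrow> w x \<ge> 0" "sum w S > 0"
  shows "ln (sum w S) + h * ((\<Sum>x\<in>S. w x * X x) / sum w S) \<le> ln (\<Sum>x\<in>S. w x * exp (h * X x))"
proof -
  define m where "m = (\<Sum>x\<in>S. w x * X x) / sum w S"
  have m: "(\<Sum>x\<in>S. w x * X x) = m * sum w S" using assms(3) by (simp add: m_def)
  have "(\<Sum>x\<in>S. w x * (1 + h * (X x - m))) =
      sum w S + h * ((\<Sum>x\<in>S. w x * X x) - m * sum w S)"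
    by (simp add: algebra_simps sum.distrib sum_subtractf sum_distrib_left)
  hence "sum w S = (\<Sum>x\<in>S. w x * (1 + h * (X x - m)))" by (simp add: m)
  also have "\<dots> \<le> (\<Sum>x\<in>S. w x * exp (h * (X x - m)))"
    using assms(2) by (intro sum_mono mult_left_mono exp_ge_add_one_self)
  finally have "exp (h * m) * sum w S \<le> exp (h * m) * (\<Sum>x\<in>S. w x * exp (h * (X x - m)))"
    by simp
  also have "\<dots> = (\<Sum>x\<in>S. w x * exp (h * X x))"
    unfolding sum_distrib_left by (intro sum.cong refl) (simp add: algebra_simps flip: exp_add)
  finally have "ln (exp (h * m) * sum w S) \<le> ln (\<Sum>x\<in>S. w x * exp (h * X x))"
    using assms(3) by (intro ln_mono) auto
  thus ?thesis using assms(3) by (simp add: ln_mult m_def add.commute)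
qed

lemma expectation_configuration_model:
  assumes "pairings (half_edges N d) \<noteq> {}"
  shows "measure_pmf.expectation (configuration_model N d) f =
    (\<Sum>P\<in>pairings (half_edges N d). f (pairing_edges P)) / real (card (pairings (half_edges N d)))"
  unfolding configuration_model_def
  by (simp add: integral_pmf_of_set[OF assms finite_pairings[OF finite_half_edges]])

text \<open>
  The field acts on the spins only and not on the multigraph, so changing it tilts the annealed
  weights by a factor that does not involve the multigraph.
\<close>

lemma annealed_weight_factorizes:
  "measure_pmf.expectation (configuration_model N d) (\<lambda>E. boltzmann_weight N \<beta> B' E \<sigma>) =
    measure_pmf.expectation (configuration_model N d) (\<lambda>E. boltzmann_weight N \<beta> B E \<sigma>) *
      exp ((B' - B) * total_spin N \<sigma>)"
proof -
  have "boltzmann_weight N \<beta> B' E \<sigma> = boltzmann_weight N \<beta> B E \<sigma> * exp ((B' - B) * total_spin N \<sigma>)" for E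
    by (simp add: boltzmann_weight_def algebra_simps flip: exp_add)
  thus ?thesis by simp
qed

lemma
  assumes "pairings (half_edges N d) \<noteq> {}"
  shows annealed_weight_pos:
      "measure_pmf.expectation (configuration_model N d) (\<lambda>E. boltzmann_weight N \<beta> B E \<sigma>) > 0"
    and annealed_partition_function_sum:
      "annealed_partition_function N d \<beta> B = (\<Sum>\<sigma>\<in>spin_configs N.
        measure_pmf.expectation (configuration_model N d) (\<lambda>E. boltzmann_weight N \<beta> B E \<sigma>))"
    and annealed_partition_function_pos: "annealed_partition_function N d \<beta> B > 0"
proof -
  have fin: "finite (pairings (half_edges N d))" by (rule finite_pairings[OF finite_half_edges])
  have pos: "measure_pmf.expectation (configuration_model N d) (\<lambda>E. boltzmann_weight N \<beta> B E \<sigma>) > 0" for \<sigma>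
    unfolding expectation_configuration_model[OF assms]
    using assms fin by (intro divide_pos_pos sum_pos) (auto simp: boltzmann_weight_def card_gt_0_iff)
  show "measure_pmf.expectation (configuration_model N d) (\<lambda>E. boltzmann_weight N \<beta> B E \<sigma>) > 0"
    by (rule pos)
  show eq: "annealed_partition_function N d \<beta> B = (\<Sum>\<sigma>\<in>spin_configs N.
        measure_pmf.expectation (configuration_model N d) (\<lambda>E. boltzmann_weight N \<beta> B E \<sigma>))"
    unfolding annealed_partition_function_def expectation_configuration_model[OF assms]
      partition_function_def sum_divide_distrib by (rule sum.swap)
  have "spin_configs N \<noteq> {}" by (simp add: spin_configs_def PiE_eq_empty_iff)
  thus "annealed_partition_function N d \<beta> B > 0"
    unfolding eq using pos finite_spin_configs by (intro sum_pos) auto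
qed

lemma annealed_pressure_subgradient:
  assumes "pairings (half_edges N d) \<noteq> {}" "N > 0"
  shows "annealed_pressure N d \<beta> B + (B' - B) * annealed_magnetization N d \<beta> B \<le> annealed_pressure N d \<beta> B'"
proof -
  define w where "w = (\<lambda>\<sigma>. measure_pmf.expectation (configuration_model N d) (\<lambda>E. boltzmann_weight N \<beta> B E \<sigma>))"
  have Z: "annealed_partition_function N d \<beta> B = sum w (spin_configs N)"
    unfolding w_def by (rule annealed_partition_function_sum[OF assms(1)])
  have Z': "annealed_partition_function N d \<beta> B' = (\<Sum>\<sigma>\<in>spin_configs N. w \<sigma> * exp ((B' - B) * total_spin N \<sigma>))"
    unfolding w_def annealed_partition_function_sum[OF assms(1)]
    by (intro sum.cong refl annealed_weight_factorizes)
  have M: "annealed_magnetization N d \<beta> B =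
      (\<Sum>\<sigma>\<in>spin_configs N. w \<sigma> * total_spin N \<sigma>) / sum w (spin_configs N) / N"
    unfolding annealed_magnetization_def annealed_expectation_def annealed_prob_def Z
    by (simp add: w_def sum_divide_distrib mult.commute)
  have "ln (sum w (spin_configs N)) + (B' - B) * ((\<Sum>\<sigma>\<in>spin_configs N. w \<sigma> * total_spin N \<sigma>) / sum w (spin_configs N))
     \<le> ln (\<Sum>\<sigma>\<in>spin_configs N. w \<sigma> * exp ((B' - B) * total_spin N \<sigma>))"
    using annealed_weight_pos[OF assms(1)] annealed_partition_function_pos[OF assms(1), of \<beta> B]
    by (intro log_sum_exp_subgradient finite_spin_configs) (auto simp: w_def less_imp_le Z[unfolded w_def])
  hence "(ln (sum w (spin_configs N)) + (B' - B) * ((\<Sum>\<sigma>\<in>spin_configs N. w \<sigma> * total_spin N \<sigma>) / sum w (spin_configs N))) / N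
     \<le> ln (\<Sum>\<sigma>\<in>spin_configs N. w \<sigma> * exp ((B' - B) * total_spin N \<sigma>)) / N"
    by (intro divide_right_mono) auto
  thus ?thesis
    unfolding annealed_pressure_def M Z Z' by (simp add: add_divide_distrib)
qed

lemma annealed_magnetization_bounded:
  assumes "pairings (half_edges N d) \<noteq> {}" "N > 0"
  shows "\<bar>annealed_magnetization N d \<beta> B\<bar> \<le> 1"
proof -
  have Z: "annealed_partition_function N d \<beta> B > 0" by (rule annealed_partition_function_pos[OF assms(1)])
  have p: "annealed_prob N d \<beta> B \<sigma> \<ge> 0" for \<sigma>
    unfolding annealed_prob_def using Z annealed_weight_pos[OF assms(1)] by (simp add: less_imp_le)
  have s: "\<bar>total_spin N \<sigma> / N\<bar> \<le> 1" if "\<sigma> \<in> spin_configs N" for \<sigma>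
  proof -
    have "\<bar>total_spin N \<sigma>\<bar> \<le> (\<Sum>i\<in>{1..N}. \<bar>\<sigma> i\<bar>)" unfolding total_spin_def by (rule sum_abs)
    also have "\<dots> \<le> (\<Sum>i\<in>{1..N}. 1)"
      using spin_configs_values[OF that] by (intro sum_mono) fastforce
    finally show ?thesis using assms(2) by simp
  qed
  have "\<bar>annealed_magnetization N d \<beta> B\<bar> \<le> (\<Sum>\<sigma>\<in>spin_configs N. \<bar>total_spin N \<sigma> / N * annealed_prob N d \<beta> B \<sigma>\<bar>)"
    unfolding annealed_magnetization_def annealed_expectation_def by (rule sum_abs)
  also have "\<dots> \<le> (\<Sum>\<sigma>\<in>spin_configs N. 1 * annealed_prob N d \<beta> B \<sigma>)"
    unfolding abs_mult using s p by (intro sum_mono mult_mono) auto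
  also have "\<dots> = 1"
    unfolding annealed_prob_def using Z annealed_partition_function_sum[OF assms(1), of \<beta> B]
    by (simp flip: sum_divide_distrib)
  finally show ?thesis .
qed

lemma annealed_pressure_lipschitz:
  assumes "pairings (half_edges N d) \<noteq> {}" "N > 0"
  shows "\<bar>annealed_pressure N d \<beta> B' - annealed_pressure N d \<beta> B\<bar> \<le> \<bar>B' - B\<bar>"
proof -
  have 1: "annealed_pressure N d \<beta> b - annealed_pressure N d \<beta> b' \<le> \<bar>b' - b\<bar>" for b b'
  proof -
    define x where "x = (b' - b) * annealed_magnetization N d \<beta> b"
    have "\<bar>x\<bar> \<le> \<bar>b' - b\<bar> * 1"
      unfolding abs_mult x_def by (intro mult_left_mono annealed_magnetization_bounded[OF assms]) auto
    hence "- x \<le> \<bar>b' - b\<bar>" by simp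
    thus ?thesis
      using annealed_pressure_subgradient[OF assms, of \<beta> b b'] unfolding x_def[symmetric] by simp
  qed
  from 1[of B B'] 1[of B' B] show ?thesis by linarith
qed

text \<open>
  Equicontinuity carries convergence over to the point \<open>b0\<close> that is missing in the second assumption.
\<close>

lemma tendsto_at_accumulation_of_lipschitz:
  fixes f :: "'i \<Rightarrow> real \<Rightarrow> real"
  assumes lip: "\<And>b. \<forall>\<^sub>F i in F. \<bar>f i b - f i b0\<bar> \<le> \<bar>b - b0\<bar>"
    and lim: "\<And>b. b \<noteq> b0 \<Longrightarrow> ((\<lambda>i. f i b) \<longlongrightarrow> \<psi> b) F" and cont: "isCont \<psi> b0"
  shows "((\<lambda>i. f i b0) \<longlongrightarrow> \<psi> b0) F"
proof (rule tendstoI)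
  fix e :: real assume e: "e > 0"
  have "(\<psi> \<longlongrightarrow> \<psi> b0) (at b0)" using cont by (simp add: isCont_def)
  hence "\<forall>\<^sub>F b in at b0. dist (\<psi> b) (\<psi> b0) < e / 3" using e by (intro tendstoD) auto
  moreover have "\<forall>\<^sub>F b in at b0. dist b b0 < e / 3"
    using e by (intro tendstoD tendsto_ident_at) auto
  moreover have "\<forall>\<^sub>F b in at b0. b \<noteq> b0" by (rule eventually_neq_at_within)
  ultimately have "\<forall>\<^sub>F b in at b0. dist (\<psi> b) (\<psi> b0) < e / 3 \<and> dist b b0 < e / 3 \<and> b \<noteq> b0"
    by eventually_elim auto
  then obtain b where b: "dist (\<psi> b) (\<psi> b0) < e / 3" "dist b b0 < e / 3" "b \<noteq> b0"
    using eventually_happens[of _ "at b0"] by auto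
  have "\<forall>\<^sub>F i in F. dist (f i b) (\<psi> b) < e / 3" using lim[OF b(3)] e by (intro tendstoD) auto
  with lip[of b] show "\<forall>\<^sub>F i in F. dist (f i b0) (\<psi> b0) < e"
    by eventually_elim (use b in \<open>unfold dist_real_def, linarith\<close>)
qed

text \<open>
  A subgradient lies between the difference quotients to the left and to the right. These converge,
  and the difference quotients of the limit are close to \<open>D\<close> near \<open>b0\<close>.
\<close>

lemma subgradients_tendsto_derivative:
  fixes f :: "'i \<Rightarrow> real \<Rightarrow> real"
  assumes sub: "\<And>b. \<forall>\<^sub>F i in F. f i b0 + (b - b0) * m i \<le> f i b"
    and lim: "\<And>b. ((\<lambda>i. f i b) \<longlongrightarrow> \<psi> b) F"
    and D: "(\<psi> has_real_derivative D) (at b0)"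
  shows "(m \<longlongrightarrow> D) F"
proof -
  have q: "((\<lambda>b. (\<psi> b - \<psi> b0) / (b - b0)) \<longlongrightarrow> D) (at b0)"
    using D by (simp add: has_field_derivative_iff)
  hence qr: "((\<lambda>b. (\<psi> b - \<psi> b0) / (b - b0)) \<longlongrightarrow> D) (at_right b0)"
    and ql: "((\<lambda>b. (\<psi> b - \<psi> b0) / (b - b0)) \<longlongrightarrow> D) (at_left b0)"
    by (auto simp: filterlim_at_split)
  have lq: "((\<lambda>i. (f i b - f i b0) / (b - b0)) \<longlongrightarrow> (\<psi> b - \<psi> b0) / (b - b0)) F" if "b \<noteq> b0" for b
    using that by (intro tendsto_intros lim) auto
  show ?thesis
  proof (rule order_tendstoI)
    fix a assume "a < D"
    have "\<forall>\<^sub>F b in at_left b0. b < b0" by (simp add: eventually_at_filter)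
    with order_tendstoD(1)[OF ql \<open>a < D\<close>] have "\<forall>\<^sub>F b in at_left b0. a < (\<psi> b - \<psi> b0) / (b - b0) \<and> b < b0"
      by (rule eventually_conj)
    then obtain b where b: "a < (\<psi> b - \<psi> b0) / (b - b0)" "b < b0"
      using eventually_happens[of _ "at_left b0"] trivial_limit_at_left_real[of b0] by auto
    have "\<forall>\<^sub>F i in F. a < (f i b - f i b0) / (b - b0)"
      using b by (intro order_tendstoD(1)[OF lq]) auto
    with sub[of b] show "\<forall>\<^sub>F i in F. a < m i"
    proof eventually_elim
      case (elim i)
      have "(f i b - f i b0) / (b - b0) \<le> m i"
        using elim(1) b(2) by (simp add: neg_divide_le_eq algebra_simps)
      thus ?case using elim(2) by linarith
    qed
  next
    fix a assume "D < a"
    have "\<forall>\<^sub>F b in at_right b0. (\<psi> b - \<psi> b0) / (b - b0) < a \<and> b0 < b"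
      using order_tendstoD(2)[OF qr \<open>D < a\<close>] eventually_at_right_less[of b0] by (rule eventually_conj)
    then obtain b where b: "(\<psi> b - \<psi> b0) / (b - b0) < a" "b0 < b"
      using eventually_happens[of _ "at_right b0"] trivial_limit_at_right_real[of b0] by auto
    have "\<forall>\<^sub>F i in F. (f i b - f i b0) / (b - b0) < a"
      using b by (intro order_tendstoD(2)[OF lq]) auto
    with sub[of b] show "\<forall>\<^sub>F i in F. m i < a"
    proof eventually_elim
      case (elim i)
      have "m i \<le> (f i b - f i b0) / (b - b0)"
        using elim(1) b(2) by (simp add: pos_le_divide_eq algebra_simps)
      thus ?case using elim(2) by linarith
    qed
  qed
qed

section \<open>Sizes with an even total degree\<close>

lemma real_even_degree_sizes: "filterlim real at_top (even_degree_sizes p)"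
  unfolding even_degree_sizes_def
  by (rule filterlim_mono[OF filterlim_real_sequentially order_refl]) simp

text \<open>
  If the total degree were odd for all large sizes, it would increase by an even number, hence by 2, at
  each step. Then \<open>\<lfloor>p * N\<rfloor>\<close> would increase by 1 at each step, which is impossible for \<open>p < 1\<close>.
\<close>

lemma even_degree_sizes_nontrivial:
  assumes "0 < p" "p < 1"
  shows "even_degree_sizes p \<noteq> bot"
proof
  assume "even_degree_sizes p = bot"
  hence "\<forall>\<^sub>F N in sequentially. odd (N + nat \<lfloor>p * real N\<rfloor>)"
    by (simp add: even_degree_sizes_def trivial_limit_def eventually_inf_principal)
  then obtain N0 where odd: "\<And>N. N \<ge> N0 \<Longrightarrow> odd (N + nat \<lfloor>p * real N\<rfloor>)"
    by (auto simp: eventually_sequentially)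
  have step: "\<lfloor>p * real (Suc N)\<rfloor> = \<lfloor>p * real N\<rfloor> + 1" if N: "N \<ge> N0" for N
  proof -
    have le: "\<lfloor>p * real N\<rfloor> \<le> \<lfloor>p * real (Suc N)\<rfloor>" "\<lfloor>p * real (Suc N)\<rfloor> \<le> \<lfloor>p * real N\<rfloor> + 1"
    proof -
      have "p * real (Suc N) = p * real N + p" by (simp add: algebra_simps)
      thus "\<lfloor>p * real N\<rfloor> \<le> \<lfloor>p * real (Suc N)\<rfloor>" "\<lfloor>p * real (Suc N)\<rfloor> \<le> \<lfloor>p * real N\<rfloor> + 1"
        using assms by linarith+
    qed
    have "\<lfloor>p * real (Suc N)\<rfloor> \<noteq> \<lfloor>p * real N\<rfloor>"
      using odd[OF N] odd[of "Suc N"] N by auto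
    thus ?thesis using le by linarith
  qed
  have grow: "\<lfloor>p * real (N0 + k)\<rfloor> = \<lfloor>p * real N0\<rfloor> + int k" for k
  proof (induction k)
    case (Suc k) thus ?case using step[of "N0 + k"] by simp
  qed simp
  obtain k :: nat where k: "real k > 1 / (1 - p)" using reals_Archimedean2 by blast
  have "real k * (1 - p) > 1" using k assms by (simp add: divide_less_eq)
  moreover have "p * real (N0 + k) = p * real N0 + p * real k" by (simp add: algebra_simps)
  moreover have "real_of_int \<lfloor>p * real N0\<rfloor> + real k \<le> p * real (N0 + k)"
    using grow[of k] by (metis of_int_add of_int_floor_le of_int_of_nat_eq)
  moreover have "p * real N0 < real_of_int \<lfloor>p * real N0\<rfloor> + 1" by linarith
  ultimately show False by (simp add: algebra_simps)
qed

lemma eventually_even_degree_sizes: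
  "\<forall>\<^sub>F N in even_degree_sizes p. N \<ge> 1 \<and> even (N + nat \<lfloor>p * real N\<rfloor>)"
  unfolding even_degree_sizes_def eventually_inf_principal
  using eventually_ge_at_top[of "1::nat"] by eventually_elim auto

lemma vertex_fractions_tendsto:
  assumes "0 < p" "p < 1"
  shows "((\<lambda>N. real (nat \<lfloor>p * real N\<rfloor>) / real N) \<longlongrightarrow> p) (even_degree_sizes p)"
    and "((\<lambda>N. real ((N - nat \<lfloor>p * real N\<rfloor>) div 2) / real N) \<longlongrightarrow> (1 - p) / 2) (even_degree_sizes p)"
proof -
  show n: "((\<lambda>N. real (nat \<lfloor>p * real N\<rfloor>) / real N) \<longlongrightarrow> p) (even_degree_sizes p)"
    using floor_grid_tendsto[OF real_even_degree_sizes, of p] assms by simp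
  have "((\<lambda>N. (1 - real (nat \<lfloor>p * real N\<rfloor>) / real N) / 2) \<longlongrightarrow> (1 - p) / 2) (even_degree_sizes p)"
    by (intro tendsto_intros n) auto
  moreover have "\<forall>\<^sub>F N in even_degree_sizes p.
      (1 - real (nat \<lfloor>p * real N\<rfloor>) / real N) / 2 = real ((N - nat \<lfloor>p * real N\<rfloor>) div 2) / real N"
    using eventually_even_degree_sizes[of p]
  proof eventually_elim
    case (elim N)
    have "p * real N \<le> real N" using assms by (simp add: mult_left_le_one_le)
    hence le: "nat \<lfloor>p * real N\<rfloor> \<le> N" by linarith
    have "even (N - nat \<lfloor>p * real N\<rfloor>)" using elim le by simp
    hence K: "real ((N - nat \<lfloor>p * real N\<rfloor>) div 2) = (real N - real (nat \<lfloor>p * real N\<rfloor>)) / 2"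
      using le by (simp add: real_of_nat_div of_nat_diff)
    show ?case unfolding K using elim by (simp add: diff_divide_distrib)
  qed
  ultimately show "((\<lambda>N. real ((N - nat \<lfloor>p * real N\<rfloor>) div 2) / real N) \<longlongrightarrow> (1 - p) / 2) (even_degree_sizes p)"
    by (rule Lim_transform_eventually)
qed

section \<open>The envelope theorem\<close>

text \<open>
  By compactness and uniqueness, the maximum points \<open>Z b\<close> converge to \<open>z0\<close>. Comparing the values at
  \<open>z0\<close> and at \<open>Z b\<close> for both parameters encloses the increment of \<open>V\<close> between the increments of two
  functions that are linear in \<open>\<alpha>\<close> and \<open>\<gamma>\<close>, with coefficients \<open>z0\<close> and \<open>Z b\<close>.
\<close>

lemma envelope_theorem:
  fixes f :: "real \<times> real \<Rightarrow> real" and \<alpha> \<gamma> V :: "real \<Rightarrow> real"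
  assumes S: "compact S" and cont: "continuous_on S f"
    and \<alpha>: "(\<alpha> has_real_derivative \<alpha>') (at b0)" and \<gamma>: "(\<gamma> has_real_derivative \<gamma>') (at b0)"
    and z0: "z0 \<in> S" "V b0 = f z0 + fst z0 * \<alpha> b0 + snd z0 * \<gamma> b0"
    and uniq: "\<And>z. z \<in> S \<Longrightarrow> z \<noteq> z0 \<Longrightarrow> f z + fst z * \<alpha> b0 + snd z * \<gamma> b0 < V b0"
    and max: "\<forall>\<^sub>F b in at b0. (\<exists>z\<in>S. V b = f z + fst z * \<alpha> b + snd z * \<gamma> b) \<and>
                (\<forall>z\<in>S. f z + fst z * \<alpha> b + snd z * \<gamma> b \<le> V b)"
  shows "(V has_real_derivative (fst z0 * \<alpha>' + snd z0 * \<gamma>')) (at b0)"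
proof -
  define G where "G = (\<lambda>b z. f z + fst z * \<alpha> b + snd z * \<gamma> b)"
  obtain Z where Z: "\<forall>\<^sub>F b in at b0. Z b \<in> S \<and> V b = G b (Z b) \<and> (\<forall>z\<in>S. G b z \<le> V b)"
  proof -
    define Z where "Z = (\<lambda>b. SOME z. z \<in> S \<and> V b = G b z)"
    have "\<forall>\<^sub>F b in at b0. Z b \<in> S \<and> V b = G b (Z b) \<and> (\<forall>z\<in>S. G b z \<le> V b)"
      using max
    proof eventually_elim
      case (elim b)
      hence "\<exists>z. z \<in> S \<and> V b = G b z" unfolding G_def by blast
      from someI_ex[OF this] elim show ?case by (simp add: Z_def G_def)
    qed
    thus ?thesis by (rule that)
  qed
  have a0: "(\<alpha> \<longlongrightarrow> \<alpha> b0) (at b0)" and g0: "(\<gamma> \<longlongrightarrow> \<gamma> b0) (at b0)"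
    using DERIV_isCont[OF \<alpha>] DERIV_isCont[OF \<gamma>] by (simp_all add: isCont_def)
  obtain R where R: "R > 0" "\<And>z. z \<in> S \<Longrightarrow> norm z \<le> R"
    using compact_imp_bounded[OF S] unfolding bounded_pos by auto
  have coord: "\<bar>fst z\<bar> \<le> R" "\<bar>snd z\<bar> \<le> R" if "z \<in> S" for z
    using R(2)[OF that] norm_fst_le[of "fst z" "snd z"] norm_snd_le[of "snd z" "fst z"] by auto
  have Zlim: "(Z \<longlongrightarrow> z0) (at b0)"
  proof (rule tendstoI)
    fix \<epsilon> :: real assume \<epsilon>: "\<epsilon> > 0"
    define S' where "S' = S - ball z0 \<epsilon>"
    have S': "compact S'" unfolding S'_def using S by (rule compact_diff) auto
    have contG: "continuous_on S' (G b0)"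
      unfolding G_def by (intro continuous_intros continuous_on_subset[OF cont]) (auto simp: S'_def)
    obtain m where m: "m < V b0" "\<And>z. z \<in> S' \<Longrightarrow> G b0 z \<le> m"
    proof (cases "S' = {}")
      case True thus ?thesis using that[of "V b0 - 1"] by auto
    next
      case False
      obtain w where w: "w \<in> S'" "\<And>z. z \<in> S' \<Longrightarrow> G b0 z \<le> G b0 w"
        using continuous_attains_sup[OF S' False contG] by auto
      have "w \<noteq> z0" using w(1) \<epsilon> by (auto simp: S'_def)
      thus ?thesis using that[of "G b0 w"] w uniq[of w] by (auto simp: S'_def G_def)
    qed
    define \<eta> where "\<eta> = (V b0 - m) / (8 * R)"
    have \<eta>: "\<eta> > 0" using m R by (simp add: \<eta>_def)
    have \<eta>R: "R * \<eta> = (V b0 - m) / 8" using R by (simp add: \<eta>_def)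
    from Z tendstoD[OF a0 \<eta>] tendstoD[OF g0 \<eta>]
    show "\<forall>\<^sub>F b in at b0. dist (Z b) z0 < \<epsilon>"
    proof eventually_elim
      case (elim b)
      have close: "\<bar>G b z - G b0 z\<bar> \<le> (V b0 - m) / 4" if "z \<in> S" for z
      proof -
        have "G b z - G b0 z = fst z * (\<alpha> b - \<alpha> b0) + snd z * (\<gamma> b - \<gamma> b0)"
          by (simp add: G_def algebra_simps)
        also have "\<bar>\<dots>\<bar> \<le> \<bar>fst z\<bar> * \<bar>\<alpha> b - \<alpha> b0\<bar> + \<bar>snd z\<bar> * \<bar>\<gamma> b - \<gamma> b0\<bar>"
          by (metis abs_mult abs_triangle_ineq)
        also have "\<dots> \<le> R * \<eta> + R * \<eta>"
          using coord[OF that] elim by (intro add_mono mult_mono) (auto simp: dist_real_def)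
        finally show ?thesis using \<eta>R by simp
      qed
      have "G b (Z b) \<ge> G b z0" using elim z0(1) by auto
      moreover have "G b0 z0 = V b0" using z0(2) by (simp add: G_def)
      ultimately have "G b0 (Z b) > m"
        using close[OF z0(1)] close[of "Z b"] elim m(1) unfolding abs_le_iff by auto
      hence "Z b \<notin> S'" using m(2)[of "Z b"] by auto
      thus ?case using elim by (simp add: S'_def dist_commute)
    qed
  qed
  define q where "q = (\<lambda>h b. (h b - h b0) / (b - b0) :: real)"
  have qa: "(q \<alpha> \<longlongrightarrow> \<alpha>') (at b0)" and qg: "(q \<gamma> \<longlongrightarrow> \<gamma>') (at b0)"
    using \<alpha> \<gamma> by (simp_all add: q_def has_field_derivative_iff)
  have main: "((\<lambda>b. fst z0 * q \<alpha> b + snd z0 * q \<gamma> b) \<longlongrightarrow> fst z0 * \<alpha>' + snd z0 * \<gamma>') (at b0)"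
    by (intro tendsto_intros qa qg)
  have "((\<lambda>b. \<bar>fst (Z b) - fst z0\<bar> * \<bar>q \<alpha> b\<bar> + \<bar>snd (Z b) - snd z0\<bar> * \<bar>q \<gamma> b\<bar>)
      \<longlongrightarrow> \<bar>fst z0 - fst z0\<bar> * \<bar>\<alpha>'\<bar> + \<bar>snd z0 - snd z0\<bar> * \<bar>\<gamma>'\<bar>) (at b0)"
    by (intro tendsto_intros qa qg Zlim)
  hence err: "((\<lambda>b. \<bar>fst (Z b) - fst z0\<bar> * \<bar>q \<alpha> b\<bar> + \<bar>snd (Z b) - snd z0\<bar> * \<bar>q \<gamma> b\<bar>) \<longlongrightarrow> 0) (at b0)"
    by simp
  have "\<forall>\<^sub>F b in at b0. norm (q V b - (fst z0 * q \<alpha> b + snd z0 * q \<gamma> b)) \<le>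
      \<bar>fst (Z b) - fst z0\<bar> * \<bar>q \<alpha> b\<bar> + \<bar>snd (Z b) - snd z0\<bar> * \<bar>q \<gamma> b\<bar>"
    using Z eventually_neq_at_within[of b0 b0 UNIV]
  proof eventually_elim
    case (elim b)
    define D where "D = V b - V b0 - (fst z0 * (\<alpha> b - \<alpha> b0) + snd z0 * (\<gamma> b - \<gamma> b0))"
    have le: "G b0 (Z b) \<le> V b0"
      using uniq[of "Z b"] z0 elim by (cases "Z b = z0") (auto simp: G_def less_imp_le)
    have "G b z0 \<le> V b" "V b0 = G b0 z0" using elim z0 by (auto simp: G_def)
    hence "D \<ge> 0" by (simp add: D_def G_def algebra_simps)
    moreover have "D \<le> (fst (Z b) - fst z0) * (\<alpha> b - \<alpha> b0) + (snd (Z b) - snd z0) * (\<gamma> b - \<gamma> b0)"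
      using le elim by (simp add: D_def G_def algebra_simps)
    ultimately have "\<bar>D\<bar> \<le> \<bar>(fst (Z b) - fst z0) * (\<alpha> b - \<alpha> b0)\<bar> + \<bar>(snd (Z b) - snd z0) * (\<gamma> b - \<gamma> b0)\<bar>"
      by linarith
    hence "\<bar>D\<bar> / \<bar>b - b0\<bar> \<le> (\<bar>(fst (Z b) - fst z0) * (\<alpha> b - \<alpha> b0)\<bar> +
        \<bar>(snd (Z b) - snd z0) * (\<gamma> b - \<gamma> b0)\<bar>) / \<bar>b - b0\<bar>"
      by (rule divide_right_mono) simp
    moreover have "q V b - (fst z0 * q \<alpha> b + snd z0 * q \<gamma> b) = D / (b - b0)"
      by (simp add: q_def D_def diff_divide_distrib add_divide_distrib right_diff_distrib)
    ultimately show ?case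
      by (simp add: q_def abs_mult add_divide_distrib abs_divide)
  qed
  hence "((\<lambda>b. q V b - (fst z0 * q \<alpha> b + snd z0 * q \<gamma> b)) \<longlongrightarrow> 0) (at b0)"
    by (rule Lim_null_comparison[OF _ err])
  from tendsto_add[OF this main] show ?thesis
    by (simp add: has_field_derivative_iff q_def)
qed

section \<open>The variational problem\<close>

lemma
  assumes "\<beta> > 0"
  shows r_ratio_pos: "r_ratio \<beta> B > 0" and r_ratio_less_1: "r_ratio \<beta> B < 1"
proof -
  have "sqrt ((sinh B)\<^sup>2 + exp (- 4 * \<beta>)) > 0" by (simp add: add_nonneg_pos)
  hence "lam_minus \<beta> B < lam_plus \<beta> B" by (simp add: lam_minus_def lam_plus_def)
  thus "r_ratio \<beta> B > 0" "r_ratio \<beta> B < 1"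
    using lam_minus_pos[OF assms, of B] lam_plus_pos[of \<beta> B] by (simp_all add: r_ratio_def)
qed

text \<open>
  The ratio of the squared coefficients of \<open>Y\<close> and \<open>X\<close> in the contribution of a vertex of degree 1.
\<close>

abbreviation pair_ratio :: "real \<Rightarrow> real \<Rightarrow> real" where
  "pair_ratio \<beta> B \<equiv> a_ratio \<beta> B * (r_ratio \<beta> B)\<^sup>2"

lemma pair_ratio_nonneg: "\<beta> > 0 \<Longrightarrow> pair_ratio \<beta> B \<ge> 0"
  using A_minus_nonneg[of \<beta> B] A_plus_pos[of \<beta> B] by (simp add: a_ratio_def)

lemma pair_ratio_eq_0_iff: "\<beta> > 0 \<Longrightarrow> pair_ratio \<beta> B = 0 \<longleftrightarrow> B = 0"
  using A_minus_eq_0_iff[of \<beta> B] A_plus_pos[of \<beta> B] r_ratio_pos[of \<beta> B] by (simp add: a_ratio_def)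

lemma pair_ratio_pos: "\<beta> > 0 \<Longrightarrow> B \<noteq> 0 \<Longrightarrow> pair_ratio \<beta> B > 0"
  using pair_ratio_nonneg[of \<beta> B] pair_ratio_eq_0_iff[of \<beta> B] by linarith

lemma lam_differentiable:
  "lam_plus \<beta> differentiable (at B)" "lam_minus \<beta> differentiable (at B)"
proof -
  have "(sinh B)\<^sup>2 + exp (- 4 * \<beta>) > 0" by (simp add: add_nonneg_pos)
  hence "\<exists>D. (lam_plus \<beta> has_real_derivative D) (at B)" "\<exists>D. (lam_minus \<beta> has_real_derivative D) (at B)"
    unfolding lam_plus_def lam_minus_def by (auto intro!: exI derivative_eq_intros)
  thus "lam_plus \<beta> differentiable (at B)" "lam_minus \<beta> differentiable (at B)"
    by (simp_all add: real_differentiable_def)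
qed

lemma exp_differentiable:
  "(\<lambda>b::real. exp b) differentiable (at B)" "(\<lambda>b::real. exp (- b)) differentiable (at B)"
  "(\<lambda>b::real. exp (\<beta> + b)) differentiable (at B)"
  unfolding real_differentiable_def by (auto intro!: exI derivative_eq_intros)

lemma A_differentiable:
  assumes "\<beta> > 0"
  shows "A_plus \<beta> differentiable (at B)" "A_minus \<beta> differentiable (at B)"
proof -
  have "exp (- 2 * \<beta>) + (lam_plus \<beta> B - exp (\<beta> + B))\<^sup>2 \<noteq> 0"
    by (metis add_pos_nonneg exp_gt_zero less_irrefl zero_le_power2)
  thus "A_plus \<beta> differentiable (at B)" "A_minus \<beta> differentiable (at B)"
    unfolding A_plus_def A_minus_def
    using lam_plus_pos[of \<beta> B] lam_minus_pos[OF assms, of B]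
    by (intro derivative_intros lam_differentiable exp_differentiable; simp)+
qed

lemma ratio_differentiable:
  assumes "\<beta> > 0"
  shows "r_ratio \<beta> differentiable (at B)" "pair_ratio \<beta> differentiable (at B)"
  unfolding r_ratio_def a_ratio_def
  using lam_plus_pos[of \<beta> B] A_plus_pos[of \<beta> B]
  by (intro derivative_intros lam_differentiable A_differentiable[OF assms]; simp)+

lemma has_derivative_deriv_ln:
  fixes f :: "real \<Rightarrow> real"
  assumes "f differentiable (at B)" "f B > 0"
  shows "((\<lambda>b. ln (f b)) has_real_derivative deriv (\<lambda>b. ln (f b)) B) (at B)"
proof -
  obtain D where "(f has_real_derivative D) (at B)" using assms(1) by (auto simp: real_differentiable_def)
  hence "((\<lambda>b. ln (f b)) has_real_derivative (1 / f B * D)) (at B)"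
    using assms(2) by (auto intro!: derivative_eq_intros)
  thus ?thesis using DERIV_imp_deriv by fastforce
qed

lemma H_finite_part_eq:
  "H_finite_part p \<beta> B (s, t) = path_entropy ((1 - p) / 2) p s t + t * ln (r_ratio \<beta> B)"
proof -
  have e: "(1 - p) / 2 - s + (p - t) = (1 + p) / 2 - s - t" "(1 - p) / 2 + p = (1 + p) / 2"
    "s + ((1 - p) / 2 - s) = (1 - p) / 2" by (simp_all add: field_simps)
  show ?thesis
    unfolding H_finite_part_def path_entropy_def mix_entropy_def xlnx_def e prod.case
    by (simp add: field_simps)
qed

text \<open>
  The function \<open>H\<close> for \<open>B \<noteq> 0\<close>, where it is finite.
\<close>

definition H_real :: "real \<Rightarrow> real \<Rightarrow> real \<Rightarrow> real \<times> real \<Rightarrow> real" where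
  "H_real p \<beta> B z = path_entropy ((1 - p) / 2) p (fst z) (snd z)
     + fst z * ln (pair_ratio \<beta> B) + snd z * ln (r_ratio \<beta> B)"

lemma H_fun_eq_H_real: "\<beta> > 0 \<Longrightarrow> B \<noteq> 0 \<Longrightarrow> H_fun p \<beta> B z = ereal (H_real p \<beta> B z)"
  using pair_ratio_eq_0_iff[of \<beta> B]
  by (cases z) (simp add: H_fun_def ext_ln_def H_finite_part_eq H_real_def)

lemma H_fun_zero_field:
  assumes "\<beta> > 0"
  shows "H_fun p \<beta> 0 (s, t) = (if s = 0 then ereal (path_entropy ((1 - p) / 2) p 0 t + t * ln (r_ratio \<beta> 0))
    else if s > 0 then - \<infinity> else \<infinity>)"
  using pair_ratio_eq_0_iff[OF assms, of 0]
  by (simp add: H_fun_def ext_ln_def H_finite_part_eq)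

lemma compact_H_domain: "compact (H_domain p)"
  unfolding H_domain_def by (intro compact_Times compact_Icc)

lemma continuous_on_path_entropy_domain:
  assumes "0 < p" "p < 1"
  shows "continuous_on (H_domain p) (\<lambda>z. path_entropy ((1 - p) / 2) p (fst z) (snd z))"
  by (intro continuous_intros) (auto simp: H_domain_def)

lemma continuous_on_H_real:
  assumes "0 < p" "p < 1"
  shows "continuous_on (H_domain p) (H_real p \<beta> B)"
  unfolding H_real_def by (intro continuous_intros continuous_on_path_entropy_domain assms)

definition z_star :: "real \<Rightarrow> real \<Rightarrow> real \<Rightarrow> real \<times> real" where
  "z_star p \<beta> B = (s_star p \<beta> B, t_star p \<beta> B)"

lemma unique_arg_max_z_star:
  assumes "z \<in> H_domain p" "\<And>w. w \<in> H_domain p \<Longrightarrow> w \<noteq> z \<Longrightarrow> H_fun p \<beta> B w < H_fun p \<beta> B z"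
  shows "\<exists>!z. is_arg_max (H_fun p \<beta> B) (\<lambda>w. w \<in> H_domain p) z" and "z_star p \<beta> B = z"
proof -
  have iff: "is_arg_max (H_fun p \<beta> B) (\<lambda>w. w \<in> H_domain p) w \<longleftrightarrow> w = z" for w
    unfolding is_arg_max_def using assms by (metis less_asym less_irrefl)
  thus "\<exists>!z. is_arg_max (H_fun p \<beta> B) (\<lambda>w. w \<in> H_domain p) z" unfolding iff by simp
  have "arg_max_on (H_fun p \<beta> B) (H_domain p) = z"
    unfolding arg_max_on_def arg_max_def iff by simp
  thus "z_star p \<beta> B = z" by (simp add: z_star_def s_star_def t_star_def)
qed

text \<open>
  Existence follows from compactness. Uniqueness holds because the entropy is strictly concave and the
  other terms are linear.
\<close>

lemma H_maximizer_nonzero_field: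
  assumes "0 < p" "p < 1" "\<beta> > 0" "B \<noteq> 0"
  shows "\<exists>!z. is_arg_max (H_fun p \<beta> B) (\<lambda>w. w \<in> H_domain p) z"
    and "z_star p \<beta> B \<in> H_domain p"
    and "\<And>w. w \<in> H_domain p \<Longrightarrow> w \<noteq> z_star p \<beta> B \<Longrightarrow> H_real p \<beta> B w < H_real p \<beta> B (z_star p \<beta> B)"
proof -
  have "(0, 0) \<in> H_domain p" using assms by (simp add: H_domain_def)
  then obtain z where z: "z \<in> H_domain p" "\<And>w. w \<in> H_domain p \<Longrightarrow> H_real p \<beta> B w \<le> H_real p \<beta> B z"
    using continuous_attains_sup[OF compact_H_domain _ continuous_on_H_real[OF assms(1,2)]] by blast
  have strict: "H_real p \<beta> B w < H_real p \<beta> B z" if w: "w \<in> H_domain p" "w \<noteq> z" for w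
  proof -
    define m where "m = ((fst z + fst w) / 2, (snd z + snd w) / 2)"
    have "m \<in> H_domain p" using z(1) w(1) by (auto simp: H_domain_def m_def)
    have "path_entropy ((1 - p) / 2) p (fst z) (snd z) + path_entropy ((1 - p) / 2) p (fst w) (snd w)
        < 2 * path_entropy ((1 - p) / 2) p (fst m) (snd m)"
      unfolding m_def fst_conv snd_conv
      using z(1) w assms by (intro path_entropy_strictly_midpoint_concave) (auto simp: H_domain_def prod_eq_iff)
    hence "H_real p \<beta> B z + H_real p \<beta> B w < 2 * H_real p \<beta> B m"
      by (simp add: H_real_def m_def field_simps)
    thus ?thesis using z(2)[OF \<open>m \<in> H_domain p\<close>] by linarith
  qed
  have str: "H_fun p \<beta> B w < H_fun p \<beta> B z" if "w \<in> H_domain p" "w \<noteq> z" for w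
    unfolding H_fun_eq_H_real[OF assms(3,4)] using strict[OF that] by simp
  note u = unique_arg_max_z_star[OF z(1) str]
  from u(1) show "\<exists>!z. is_arg_max (H_fun p \<beta> B) (\<lambda>w. w \<in> H_domain p) z" .
  show "z_star p \<beta> B \<in> H_domain p"
    "\<And>w. w \<in> H_domain p \<Longrightarrow> w \<noteq> z_star p \<beta> B \<Longrightarrow> H_real p \<beta> B w < H_real p \<beta> B (z_star p \<beta> B)"
    using z(1) strict by (simp_all add: u(2))
qed

text \<open>
  Points with \<open>s > 0\<close> have the value \<open>- \<infinity>\<close>, and on the edge \<open>s = 0\<close> the function is negative away from
  the origin.
\<close>

lemma H_maximizer_zero_field:
  assumes "0 < p" "p < 1" "\<beta> > 0"
  shows "\<exists>!z. is_arg_max (H_fun p \<beta> 0) (\<lambda>w. w \<in> H_domain p) z" and "z_star p \<beta> 0 = (0, 0)"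
proof -
  have "H_fun p \<beta> 0 w < H_fun p \<beta> 0 (0, 0)" if "w \<in> H_domain p" "w \<noteq> (0, 0)" for w
    using that assms path_entropy_0_less[of "(1 - p) / 2" "r_ratio \<beta> 0" "snd w" p]
      r_ratio_pos[OF assms(3), of 0] r_ratio_less_1[OF assms(3), of 0]
    by (cases w) (auto simp: H_fun_zero_field H_domain_def)
  moreover have "(0, 0) \<in> H_domain p" using assms by (simp add: H_domain_def)
  ultimately show "\<exists>!z. is_arg_max (H_fun p \<beta> 0) (\<lambda>w. w \<in> H_domain p) z" "z_star p \<beta> 0 = (0, 0)"
    using unique_arg_max_z_star[of "(0, 0)" p \<beta> 0] by blast+
qed

definition H_max :: "real \<Rightarrow> real \<Rightarrow> real \<Rightarrow> real" where
  "H_max p \<beta> B = real_of_ereal (H_fun p \<beta> B (z_star p \<beta> B))"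

lemma H_fun_z_star:
  assumes "0 < p" "p < 1" "\<beta> > 0"
  shows "H_fun p \<beta> B (z_star p \<beta> B) = ereal (H_max p \<beta> B)"
proof (cases "B = 0")
  case True
  thus ?thesis using H_maximizer_zero_field[OF assms] by (simp add: H_max_def H_fun_zero_field[OF assms(3)])
next
  case False
  thus ?thesis using assms by (simp add: H_max_def H_fun_eq_H_real)
qed

lemma H_max_nonzero_field: "\<beta> > 0 \<Longrightarrow> B \<noteq> 0 \<Longrightarrow> H_max p \<beta> B = H_real p \<beta> B (z_star p \<beta> B)"
  by (simp add: H_max_def H_fun_eq_H_real)

lemma H_max_zero_field: "0 < p \<Longrightarrow> p < 1 \<Longrightarrow> \<beta> > 0 \<Longrightarrow> H_max p \<beta> 0 = 0"
  by (simp add: H_max_def H_maximizer_zero_field H_fun_zero_field)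

lemma H_real_le_H_max:
  assumes "0 < p" "p < 1" "\<beta> > 0" "B \<noteq> 0" "z \<in> H_domain p"
  shows "H_real p \<beta> B z \<le> H_max p \<beta> B"
  using H_maximizer_nonzero_field(3)[OF assms(1-5)] H_max_nonzero_field[OF assms(3,4), of p]
  by (cases "z = z_star p \<beta> B") (auto simp: less_imp_le)

text \<open>
  The value at the origin is \<open>0\<close>, and the upper bound is \<open>path_entropy_tilted_le\<close> together with
  \<open>ln (1 + x) \<le> x\<close>.
\<close>

lemma H_max_bounds:
  assumes "0 < p" "p < 1" "\<beta> > 0"
  shows "0 \<le> H_max p \<beta> B" "H_max p \<beta> B \<le> (1 - p) / 2 * pair_ratio \<beta> B"
proof -
  define \<nu> where "\<nu> = (1 - p) / 2"
  have \<nu>: "\<nu> > 0" using assms by (simp add: \<nu>_def)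
  have "0 \<le> H_max p \<beta> B \<and> H_max p \<beta> B \<le> \<nu> * pair_ratio \<beta> B"
  proof (cases "B = 0")
    case True
    thus ?thesis using assms H_max_zero_field pair_ratio_nonneg[OF assms(3), of B] \<nu> by simp
  next
    case False
    let ?c = "pair_ratio \<beta> B" and ?r = "r_ratio \<beta> B"
    have c: "?c > 0" by (rule pair_ratio_pos[OF assms(3) False])
    have r: "0 < ?r" "?r < 1" using r_ratio_pos r_ratio_less_1 assms by auto
    have dom: "z_star p \<beta> B \<in> H_domain p" by (rule H_maximizer_nonzero_field[OF assms False])
    have "(0, 0) \<in> H_domain p" using assms by (simp add: H_domain_def)
    from H_real_le_H_max[OF assms False this] have "0 \<le> H_max p \<beta> B" by (simp add: H_real_def)
    moreover have "H_max p \<beta> B \<le> \<nu> * ln (1 + ?c * \<nu> / (\<nu> + p - ?r * p))"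
      unfolding H_max_nonzero_field[OF assms(3) False] H_real_def \<nu>_def[symmetric]
      using dom \<nu> assms c r by (intro path_entropy_tilted_le) (auto simp: H_domain_def \<nu>_def)
    moreover have "ln (1 + ?c * \<nu> / (\<nu> + p - ?r * p)) \<le> ?c"
    proof -
      have "?r * p \<le> p" using r assms by (simp add: mult_left_le_one_le)
      hence den: "\<nu> + p - ?r * p \<ge> \<nu>" by simp
      have "ln (1 + ?c * \<nu> / (\<nu> + p - ?r * p)) \<le> ?c * \<nu> / (\<nu> + p - ?r * p)"
        using den c \<nu> by (intro ln_add_one_self_le_self) auto
      also have "\<dots> \<le> ?c * \<nu> / \<nu>" using den c \<nu> by (intro divide_left_mono) auto
      finally show ?thesis using \<nu> by simp
    qed
    ultimately show ?thesis using \<nu> by (meson mult_left_mono order.trans less_imp_le)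
  qed
  thus "0 \<le> H_max p \<beta> B" "H_max p \<beta> B \<le> (1 - p) / 2 * pair_ratio \<beta> B" by (simp_all add: \<nu>_def)
qed

text \<open>
  For \<open>B \<noteq> 0\<close> this is the envelope theorem. At \<open>B = 0\<close> the factor \<open>ln (pair_ratio \<beta> b)\<close> is singular, but
  its coefficient \<open>s_star p \<beta> 0\<close> is \<open>0\<close>. There \<open>H_max\<close> is squeezed between \<open>0\<close> and a multiple of
  \<open>pair_ratio\<close>, which has a minimum at \<open>0\<close> and hence the derivative \<open>0\<close>.
\<close>

lemma H_max_has_derivative:
  assumes "0 < p" "p < 1" "\<beta> > 0"
  shows "(H_max p \<beta> has_real_derivative
     (s_star p \<beta> B * deriv (\<lambda>b. ln (pair_ratio \<beta> b)) B + t_star p \<beta> B * deriv (\<lambda>b. ln (r_ratio \<beta> b)) B)) (at B)"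
proof (cases "B = 0")
  case False
  have near: "\<forall>\<^sub>F b in at B. b \<noteq> 0"
    using False by (intro tendsto_imp_eventually_ne[OF tendsto_ident_at]) auto
  have "(H_max p \<beta> has_real_derivative
     (fst (z_star p \<beta> B) * deriv (\<lambda>b. ln (pair_ratio \<beta> b)) B +
      snd (z_star p \<beta> B) * deriv (\<lambda>b. ln (r_ratio \<beta> b)) B)) (at B)"
  proof (rule envelope_theorem[OF compact_H_domain continuous_on_path_entropy_domain[OF assms(1,2)]])
    show "((\<lambda>b. ln (pair_ratio \<beta> b)) has_real_derivative deriv (\<lambda>b. ln (pair_ratio \<beta> b)) B) (at B)"
      by (rule has_derivative_deriv_ln[OF ratio_differentiable(2)[OF assms(3)] pair_ratio_pos[OF assms(3) False]])
    show "((\<lambda>b. ln (r_ratio \<beta> b)) has_real_derivative deriv (\<lambda>b. ln (r_ratio \<beta> b)) B) (at B)"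
      by (rule has_derivative_deriv_ln[OF ratio_differentiable(1)[OF assms(3)] r_ratio_pos[OF assms(3)]])
    show "z_star p \<beta> B \<in> H_domain p" by (rule H_maximizer_nonzero_field[OF assms False])
    show "H_max p \<beta> B = path_entropy ((1 - p) / 2) p (fst (z_star p \<beta> B)) (snd (z_star p \<beta> B)) +
        fst (z_star p \<beta> B) * ln (pair_ratio \<beta> B) + snd (z_star p \<beta> B) * ln (r_ratio \<beta> B)"
      by (simp add: H_max_nonzero_field[OF assms(3) False] H_real_def)
    show "path_entropy ((1 - p) / 2) p (fst z) (snd z) + fst z * ln (pair_ratio \<beta> B) +
        snd z * ln (r_ratio \<beta> B) < H_max p \<beta> B" if "z \<in> H_domain p" "z \<noteq> z_star p \<beta> B" for z
      using H_maximizer_nonzero_field(3)[OF assms False that]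
      by (simp add: H_max_nonzero_field[OF assms(3) False] H_real_def)
    show "\<forall>\<^sub>F b in at B.
       (\<exists>z\<in>H_domain p. H_max p \<beta> b = path_entropy ((1 - p) / 2) p (fst z) (snd z) +
            fst z * ln (pair_ratio \<beta> b) + snd z * ln (r_ratio \<beta> b)) \<and>
       (\<forall>z\<in>H_domain p. path_entropy ((1 - p) / 2) p (fst z) (snd z) +
            fst z * ln (pair_ratio \<beta> b) + snd z * ln (r_ratio \<beta> b) \<le> H_max p \<beta> b)"
      using near
    proof eventually_elim
      case (elim b)
      show ?case
        using H_maximizer_nonzero_field(2)[OF assms elim] H_max_nonzero_field[OF assms(3) elim, of p]
          H_real_le_H_max[OF assms elim] unfolding H_real_def by blast
    qed
  qed
  thus ?thesis by (simp add: z_star_def)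
next
  case True
  have st: "s_star p \<beta> B = 0" "t_star p \<beta> B = 0"
    using H_maximizer_zero_field(2)[OF assms] True by (simp_all add: z_star_def)
  obtain D where D: "(pair_ratio \<beta> has_real_derivative D) (at 0)"
    using ratio_differentiable(2)[OF assms(3)] by (auto simp: real_differentiable_def)
  have c0: "pair_ratio \<beta> 0 = 0" using pair_ratio_eq_0_iff[OF assms(3)] by blast
  \<comment> \<open>the ratio is nonnegative and vanishes at \<open>0\<close>\<close>
  have "D = 0"
    by (rule DERIV_local_min[OF D zero_less_one]) (use pair_ratio_nonneg[OF assms(3)] in \<open>unfold c0, simp\<close>)
  hence q: "((\<lambda>b. pair_ratio \<beta> b / b) \<longlongrightarrow> 0) (at 0)"
    using D c0 by (simp add: has_field_derivative_iff)
  have "((\<lambda>b. (1 - p) / 2 * \<bar>pair_ratio \<beta> b / b\<bar>) \<longlongrightarrow> (1 - p) / 2 * \<bar>0\<bar>) (at 0)"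
    by (intro tendsto_intros q)
  hence bound: "((\<lambda>b. (1 - p) / 2 * \<bar>pair_ratio \<beta> b / b\<bar>) \<longlongrightarrow> 0) (at 0)" by simp
  have "norm (H_max p \<beta> b / b) \<le> (1 - p) / 2 * \<bar>pair_ratio \<beta> b / b\<bar>" for b
  proof -
    have "\<bar>H_max p \<beta> b\<bar> / \<bar>b\<bar> \<le> ((1 - p) / 2 * pair_ratio \<beta> b) / \<bar>b\<bar>"
      using H_max_bounds[OF assms, of b] by (intro divide_right_mono) auto
    also have "\<dots> = (1 - p) / 2 * \<bar>pair_ratio \<beta> b / b\<bar>"
      using pair_ratio_nonneg[OF assms(3), of b] by (simp only: abs_divide abs_of_nonneg times_divide_eq_right)
    finally show ?thesis by (simp only: real_norm_def abs_divide)
  qed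
  hence "((\<lambda>b. H_max p \<beta> b / b) \<longlongrightarrow> 0) (at 0)"
    by (intro Lim_null_comparison[OF _ bound] always_eventually) blast
  thus ?thesis
    using H_max_zero_field[OF assms] by (simp add: True st[unfolded True] has_field_derivative_iff)
qed

section \<open>The thermodynamic limit\<close>

definition pressure_formula :: "real \<Rightarrow> real \<Rightarrow> real \<Rightarrow> real" where
  "pressure_formula p \<beta> B = ln (lam_plus \<beta> B) + (1 - p) / 2 * ln (A_plus \<beta> B) + H_max p \<beta> B"

lemma pressure_formula_has_derivative:
  assumes "0 < p" "p < 1" "\<beta> > 0"
  shows "(pressure_formula p \<beta> has_real_derivative
     (deriv (\<lambda>b. ln (lam_plus \<beta> b)) B + (1 - p) / 2 * deriv (\<lambda>b. ln (A_plus \<beta> b)) B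
      + s_star p \<beta> B * deriv (\<lambda>b. ln (pair_ratio \<beta> b)) B
      + t_star p \<beta> B * deriv (\<lambda>b. ln (r_ratio \<beta> b)) B)) (at B)"
proof -
  note 1 = has_derivative_deriv_ln[OF lam_differentiable(1) lam_plus_pos, of \<beta> B]
  note 2 = has_derivative_deriv_ln[OF A_differentiable(1)[OF assms(3)] A_plus_pos, of B]
  show ?thesis
    using DERIV_add[OF DERIV_add[OF 1 DERIV_cmult[OF 2, of "(1 - p) / 2"]] H_max_has_derivative[OF assms, of B]]
    unfolding pressure_formula_def by (simp add: add.assoc)
qed

lemma CM12_partition_function:
  assumes "0 < p" "p < 1" "\<beta> > 0" "CM12_degrees p N d" "N \<ge> 1" "even (N + nat \<lfloor>p * real N\<rfloor>)"
    and n: "n = nat \<lfloor>p * real N\<rfloor>" and K: "K = (N - nat \<lfloor>p * real N\<rfloor>) div 2"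
  shows "annealed_partition_function N d \<beta> B =
      lam_plus \<beta> B ^ N * A_plus \<beta> B ^ K * gauss_sum K n (pair_ratio \<beta> B) (r_ratio \<beta> B)"
    and "pairings (half_edges N d) \<noteq> {}"
proof -
  have "p * real N \<le> real N" using assms by (simp add: mult_left_le_one_le)
  hence le: "n \<le> N" unfolding n by linarith
  have "even (N - n)" using assms(6) le n by simp
  hence N: "N = 2 * K + n" using le by (simp add: K n[symmetric])
  have deg: "d i = 1 \<or> d i = 2" if "i \<in> {1..N}" for i
    using assms(4) that by (simp add: CM12_degrees_def)
  have card: "card {i\<in>{1..N}. d i = 2} = n" using assms(4) n by (simp add: CM12_degrees_def)
  show "annealed_partition_function N d \<beta> B =
      lam_plus \<beta> B ^ N * A_plus \<beta> B ^ K * gauss_sum K n (pair_ratio \<beta> B) (r_ratio \<beta> B)"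
    by (rule annealed_partition_function_eq(1)[OF assms(3) deg card N])
  show "pairings (half_edges N d) \<noteq> {}"
    by (rule annealed_partition_function_eq(2)[OF assms(3) deg card N])
qed

lemma annealed_pressure_tendsto_nonzero_field:
  assumes "0 < p" "p < 1" "\<beta> > 0" "B \<noteq> 0" and d: "\<And>N. N \<ge> 1 \<Longrightarrow> CM12_degrees p N (d N)"
  shows "((\<lambda>N. annealed_pressure N (d N) \<beta> B) \<longlongrightarrow> pressure_formula p \<beta> B) (even_degree_sizes p)"
proof -
  let ?c = "pair_ratio \<beta> B" and ?r = "r_ratio \<beta> B"
  define n where "n = (\<lambda>N. nat \<lfloor>p * real N\<rfloor>)"
  define K where "K = (\<lambda>N. (N - nat \<lfloor>p * real N\<rfloor>) div 2)"
  have nlim: "((\<lambda>N. real (n N) / real N) \<longlongrightarrow> p) (even_degree_sizes p)"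
    and Klim: "((\<lambda>N. real (K N) / real N) \<longlongrightarrow> (1 - p) / 2) (even_degree_sizes p)"
    unfolding n_def K_def by (rule vertex_fractions_tendsto[OF assms(1,2)])+
  have dom: "z_star p \<beta> B \<in> H_domain p" by (rule H_maximizer_nonzero_field[OF assms(1-4)])
  have W: "((\<lambda>N. ln (gauss_sum (K N) (n N) ?c ?r) / real N) \<longlongrightarrow> H_max p \<beta> B) (even_degree_sizes p)"
  proof (rule gauss_sum_exponential_rate[OF real_even_degree_sizes Klim nlim])
    show "H_max p \<beta> B = path_entropy ((1 - p) / 2) p (fst (z_star p \<beta> B)) (snd (z_star p \<beta> B)) +
        fst (z_star p \<beta> B) * ln ?c + snd (z_star p \<beta> B) * ln ?r"
      by (simp add: H_max_nonzero_field[OF assms(3,4)] H_real_def)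
    show "path_entropy ((1 - p) / 2) p s t + s * ln ?c + t * ln ?r \<le> H_max p \<beta> B"
      if "0 \<le> s" "s \<le> (1 - p) / 2" "0 \<le> t" "t \<le> p" for s t
      using H_real_le_H_max[OF assms(1-4), of "(s, t)"] that by (simp add: H_real_def H_domain_def)
  qed (use assms dom pair_ratio_pos r_ratio_pos in \<open>auto simp: H_domain_def\<close>)
  have "((\<lambda>N. ln (lam_plus \<beta> B) + real (K N) / real N * ln (A_plus \<beta> B) + ln (gauss_sum (K N) (n N) ?c ?r) / real N)
      \<longlongrightarrow> pressure_formula p \<beta> B) (even_degree_sizes p)"
    unfolding pressure_formula_def by (intro tendsto_intros Klim W)
  moreover have "\<forall>\<^sub>F N in even_degree_sizes p.
      ln (lam_plus \<beta> B) + real (K N) / real N * ln (A_plus \<beta> B) + ln (gauss_sum (K N) (n N) ?c ?r) / real N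
      = annealed_pressure N (d N) \<beta> B"
    using eventually_even_degree_sizes[of p]
  proof eventually_elim
    case (elim N)
    have Z: "annealed_partition_function N (d N) \<beta> B =
        lam_plus \<beta> B ^ N * A_plus \<beta> B ^ K N * gauss_sum (K N) (n N) ?c ?r"
      and ne: "pairings (half_edges N (d N)) \<noteq> {}"
      using CM12_partition_function[OF assms(1-3) d _ _ refl refl] elim by (simp_all add: n_def K_def)
    have "lam_plus \<beta> B ^ N * A_plus \<beta> B ^ K N > 0"
      using lam_plus_pos[of \<beta> B] A_plus_pos[of \<beta> B] by simp
    hence "gauss_sum (K N) (n N) ?c ?r > 0"
      using annealed_partition_function_pos[OF ne, of \<beta> B] unfolding Z by (rule zero_less_mult_pos[rotated])
    hence "ln (annealed_partition_function N (d N) \<beta> B) =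
        N * ln (lam_plus \<beta> B) + K N * ln (A_plus \<beta> B) + ln (gauss_sum (K N) (n N) ?c ?r)"
      unfolding Z using lam_plus_pos[of \<beta> B] A_plus_pos[of \<beta> B] by (simp add: ln_mult ln_realpow)
    thus ?case using elim by (simp add: annealed_pressure_def add_divide_distrib)
  qed
  ultimately show ?thesis by (rule Lim_transform_eventually)
qed

theorem theorem1p7:
  fixes p \<beta> B :: real and d :: "nat \<Rightarrow> nat \<Rightarrow> nat"
  assumes "0 < p" and "p < 1"
    and "\<And>N. N \<ge> 1 \<Longrightarrow> CM12_degrees p N (d N)"
    and "\<beta> > 0"
  shows "(\<exists>!z. is_arg_max (H_fun p \<beta> B) (\<lambda>w. w \<in> H_domain p) z)
    \<and> ((\<lambda>N. annealed_pressure N (d N) \<beta> B) \<longlongrightarrow> limit_pressure p d \<beta> B) (even_degree_sizes p)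
    \<and> ereal (limit_pressure p d \<beta> B)
        = ereal (ln (lam_plus \<beta> B) + (1 - p) / 2 * ln (A_plus \<beta> B))
          + H_fun p \<beta> B (s_star p \<beta> B, t_star p \<beta> B)
    \<and> ((\<lambda>N. annealed_magnetization N (d N) \<beta> B) \<longlongrightarrow> limit_magnetization p d \<beta> B)
        (even_degree_sizes p)
    \<and> ((\<lambda>b. limit_pressure p d \<beta> b) has_real_derivative limit_magnetization p d \<beta> B) (at B)
    \<and> limit_magnetization p d \<beta> B
        = deriv (\<lambda>b. ln (lam_plus \<beta> b)) B
          + (1 - p) / 2 * deriv (\<lambda>b. ln (A_plus \<beta> b)) B
          + s_star p \<beta> B * deriv (\<lambda>b. ln (a_ratio \<beta> b * (r_ratio \<beta> b)\<^sup>2)) B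
          + t_star p \<beta> B * deriv (\<lambda>b. ln (r_ratio \<beta> b)) B"
proof -
  let ?F = "even_degree_sizes p"
  note p = assms(1,2,4)
  have ne: "\<forall>\<^sub>F N in ?F. pairings (half_edges N (d N)) \<noteq> {} \<and> N > 0"
    using eventually_even_degree_sizes[of p]
    by eventually_elim (use CM12_partition_function(2)[OF p assms(3) _ _ refl refl] in auto)
  have deriv: "(pressure_formula p \<beta> has_real_derivative
     (deriv (\<lambda>b. ln (lam_plus \<beta> b)) b + (1 - p) / 2 * deriv (\<lambda>b. ln (A_plus \<beta> b)) b
      + s_star p \<beta> b * deriv (\<lambda>b. ln (a_ratio \<beta> b * (r_ratio \<beta> b)\<^sup>2)) b
      + t_star p \<beta> b * deriv (\<lambda>b. ln (r_ratio \<beta> b)) b)) (at b)" for b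
    by (rule pressure_formula_has_derivative[OF p])
  have lim: "((\<lambda>N. annealed_pressure N (d N) \<beta> b) \<longlongrightarrow> pressure_formula p \<beta> b) ?F" for b
  proof (cases "b = 0")
    case False
    thus ?thesis using p assms(3) by (intro annealed_pressure_tendsto_nonzero_field)
  next
    case True
    have "((\<lambda>N. annealed_pressure N (d N) \<beta> 0) \<longlongrightarrow> pressure_formula p \<beta> 0) ?F"
    proof (rule tendsto_at_accumulation_of_lipschitz[where f = "\<lambda>N. annealed_pressure N (d N) \<beta>"])
      show "\<forall>\<^sub>F N in ?F. \<bar>annealed_pressure N (d N) \<beta> b - annealed_pressure N (d N) \<beta> 0\<bar> \<le> \<bar>b - 0\<bar>" for b
        using ne by eventually_elim (blast intro: annealed_pressure_lipschitz)
      show "isCont (pressure_formula p \<beta>) 0" by (rule DERIV_isCont[OF deriv])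
    qed (use p assms(3) in \<open>intro annealed_pressure_tendsto_nonzero_field\<close>)
    thus ?thesis by (simp add: True)
  qed
  have F: "?F \<noteq> bot" by (rule even_degree_sizes_nontrivial[OF assms(1,2)])
  have P: "limit_pressure p d \<beta> b = pressure_formula p \<beta> b" for b
    unfolding limit_pressure_def by (rule tendsto_Lim[OF F lim])
  have mag: "((\<lambda>N. annealed_magnetization N (d N) \<beta> B) \<longlongrightarrow>
      deriv (\<lambda>b. ln (lam_plus \<beta> b)) B + (1 - p) / 2 * deriv (\<lambda>b. ln (A_plus \<beta> b)) B
      + s_star p \<beta> B * deriv (\<lambda>b. ln (a_ratio \<beta> b * (r_ratio \<beta> b)\<^sup>2)) B
      + t_star p \<beta> B * deriv (\<lambda>b. ln (r_ratio \<beta> b)) B) ?F"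
  proof (rule subgradients_tendsto_derivative[OF _ lim deriv])
    show "\<forall>\<^sub>F N in ?F. annealed_pressure N (d N) \<beta> B + (b - B) * annealed_magnetization N (d N) \<beta> B
        \<le> annealed_pressure N (d N) \<beta> b" for b
      using ne by eventually_elim (blast intro: annealed_pressure_subgradient)
  qed
  note M = tendsto_Lim[OF F mag, folded limit_magnetization_def]
  have "\<exists>!z. is_arg_max (H_fun p \<beta> B) (\<lambda>w. w \<in> H_domain p) z"
    using H_maximizer_zero_field(1)[OF p] H_maximizer_nonzero_field(1)[OF p] by (cases "B = 0") auto
  moreover have "ereal (pressure_formula p \<beta> B)
        = ereal (ln (lam_plus \<beta> B) + (1 - p) / 2 * ln (A_plus \<beta> B))
          + H_fun p \<beta> B (s_star p \<beta> B, t_star p \<beta> B)"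
    using H_fun_z_star[OF p, of B] by (simp add: z_star_def pressure_formula_def)
  ultimately show ?thesis
    unfolding P M using lim[of B] mag deriv[of B] by blast
qed

end
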